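(* Let $N^{H_1,H_2}(a,b)=\{N_t^{H_1,H_2}(a,b),\,t\ge 0\}$ be a generalized mixed fractional Brownian motion with $0<H_1\le H_2<1$ and $a,b\in\mathbb{R}$ not both zero. Let $S^{\lambda,\alpha}=\{S_t^{\lambda,\alpha},\,t\ge 0\}$ be a tempered stable subordinator with tempering parameter $\lambda>0$ and index $0<\alpha<1$, independent of the two fractional Brownian motions $B^{H_1},B^{H_2}$ defining $N^{H_1,H_2}(a,b)$. If $2H_1-H_2<1$, then the time-changed process $\{N^{H_1,H_2}_{S_t^{\lambda,\alpha}}(a,b),\,t\ge 0\}$ has the long-range dependence property.
   Context: Fractional Brownian motion $B^H=\{B^H_t,t\ge0\}$ with Hurst parameter $H\in(0,1)$ is the Gaussian process with continuous sample paths such that $B^H_0=0$, $E(B^H_t)=0$ and $E(B^H_sB^H_t)=\frac12[s^{2H}+t^{2H}-|s-t|^{2H}]$ for $s,t\ge0$. Generalized mixed fractional Brownian motion with Hurst indices $H_1,H_2\in(0,1)$: $N_t^{H_1,H_2}(a,b)=aB_t^{H_1}+bB_t^{H_2}$, $t\ge0$, where $B^{H_1}$ and $B^{H_2}$ are independent fractional Brownian motions and $a,b\in\mathbb{R}$ are not both zero. Tempered stable subordinator with index $\alpha\in(0,1)$ and tempering parameter $\lambda>0$: the non-decreasing non-negative Lévy process $S^{\lambda,\alpha}$ such that $S_t^{\lambda,\alpha}$ has probability density function $$f_{\lambda,\alpha}(x,t)=\exp(-\lambda x+\lambda^\alpha t)f_\alpha(x,t),\qquad f_\alpha(x,t)=\frac1\pi\int_0^\infty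 e^{-xy}e^{-ty^\alpha\cos\alpha\pi}\sin(ty^\alpha\sin\alpha\pi)\,dy .$$ Long-range dependence: let $\{X_t,t\ge0\}$ be a stochastic process with $E(X_t^2)<\infty$ for all $t\ge0$. It is said to be long-range dependent if, for any fixed $s>0$ (with $t>s$), $$\mathrm{Corr}(X_t,X_s)\simeq c(s)t^{-d}\quad\text{as } t\to\infty$$ for some constant $c(s)$ depending only on $s$. The definition specifies no range for the exponent $d$. Here $\simeq$ denotes asymptotic equivalence as $t\to\infty$. *)

theory Defs
  imports "HOL-Probability.Probability" "HOL-Library.Landau_Symbols"
begin

text \<open>
  A real-valued process \<open>{X t, t \<ge> 0}\<close> on \<open>M\<close> is a function \<open>X :: real \<Rightarrow> 'a \<Rightarrow> real\<close>;
  its values at negative times are irrelevant and never constrained.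
\<close>

definition stochastic_process :: "'a measure \<Rightarrow> (real \<Rightarrow> 'a \<Rightarrow> real) \<Rightarrow> bool" where
  "stochastic_process M X \<longleftrightarrow> (\<forall>t\<ge>0. X t \<in> borel_measurable M)"

text \<open>The \<open>\<sigma>\<close>-algebra generated jointly by all the processes in \<open>\<X>\<close>.\<close>

definition process_sigma :: "'a measure \<Rightarrow> (real \<Rightarrow> 'a \<Rightarrow> real) set \<Rightarrow> 'a set set" where
  "process_sigma M \<X> =
     sigma_sets (space M) {X t -` A \<inter> space M | X t A. X \<in> \<X> \<and> 0 \<le> t \<and> A \<in> sets borel}"

text \<open>Degenerate (constant) Gaussians need a separate clause, because \<open>normal_density \<mu> 0\<close> is \<open>0\<close>.\<close>

definition gaussian_rv :: "'a measure \<Rightarrow> ('a \<Rightarrow> real) \<Rightarrow> bool" where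
  "gaussian_rv M Y \<longleftrightarrow> Y \<in> borel_measurable M \<and>
     ((\<exists>\<mu> \<sigma>. 0 < \<sigma> \<and> distributed M lborel Y (\<lambda>x. ennreal (normal_density \<mu> \<sigma> x))) \<or>
      (\<exists>\<mu>. AE \<omega> in M. Y \<omega> = \<mu>))"

text \<open>Finite-dimensional laws are multivariate normal, i.e. all their linear functionals are normal.\<close>

definition gaussian_process :: "'a measure \<Rightarrow> (real \<Rightarrow> 'a \<Rightarrow> real) \<Rightarrow> bool" where
  "gaussian_process M X \<longleftrightarrow> stochastic_process M X \<and>
     (\<forall>(I :: real set) (c :: real \<Rightarrow> real). finite I \<and> I \<subseteq> {0..} \<longrightarrow>
        gaussian_rv M (\<lambda>\<omega>. \<Sum>t\<in>I. c t * X t \<omega>))"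

definition fractional_brownian_motion ::
    "'a measure \<Rightarrow> real \<Rightarrow> (real \<Rightarrow> 'a \<Rightarrow> real) \<Rightarrow> bool" where
  "fractional_brownian_motion M H B \<longleftrightarrow>
     0 < H \<and> H < 1 \<and>
     gaussian_process M B \<and>
     (\<forall>\<omega>\<in>space M. continuous_on {0..} (\<lambda>t. B t \<omega>)) \<and>
     (AE \<omega> in M. B 0 \<omega> = 0) \<and>
     (\<forall>t\<ge>0. integral\<^sup>L M (B t) = 0) \<and>
     (\<forall>s\<ge>0. \<forall>t\<ge>0. integral\<^sup>L M (\<lambda>\<omega>. B s \<omega> * B t \<omega>) =
        1 / 2 * (s powr (2 * H) + t powr (2 * H) - \<bar>s - t\<bar> powr (2 * H)))"

definition mixed_process ::
    "real \<Rightarrow> real \<Rightarrow> (real \<Rightarrow> 'a \<Rightarrow> real) \<Rightarrow> (real \<Rightarrow> 'a \<Rightarrow> real) \<Rightarrow> real \<Rightarrow> 'a \<Rightarrow> real" where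
  "mixed_process a b B1 B2 t \<omega> = a * B1 t \<omega> + b * B2 t \<omega>"

definition generalized_mixed_fbm ::
    "'a measure \<Rightarrow> real \<Rightarrow> real \<Rightarrow> real \<Rightarrow> real \<Rightarrow>
     (real \<Rightarrow> 'a \<Rightarrow> real) \<Rightarrow> (real \<Rightarrow> 'a \<Rightarrow> real) \<Rightarrow> (real \<Rightarrow> 'a \<Rightarrow> real) \<Rightarrow> bool" where
  "generalized_mixed_fbm M H1 H2 a b B1 B2 N \<longleftrightarrow>
     \<not> (a = 0 \<and> b = 0) \<and>
     fractional_brownian_motion M H1 B1 \<and>
     fractional_brownian_motion M H2 B2 \<and>
     prob_space.indep_set M (process_sigma M {B1}) (process_sigma M {B2}) \<and>
     N = mixed_process a b B1 B2"

text \<open>No path regularity is required here beyond stochastic continuity.\<close>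

definition levy_process :: "'a measure \<Rightarrow> (real \<Rightarrow> 'a \<Rightarrow> real) \<Rightarrow> bool" where
  "levy_process M X \<longleftrightarrow>
     stochastic_process M X \<and>
     (AE \<omega> in M. X 0 \<omega> = 0) \<and>
     (\<forall>(n :: nat) (t :: nat \<Rightarrow> real). 0 \<le> t 0 \<and> (\<forall>i<n. t i \<le> t (Suc i)) \<longrightarrow>
        prob_space.indep_vars M (\<lambda>_. borel) (\<lambda>i \<omega>. X (t (Suc i)) \<omega> - X (t i) \<omega>) {..<n}) \<and>
     (\<forall>s t. 0 \<le> s \<and> s \<le> t \<longrightarrow>
        distr M borel (\<lambda>\<omega>. X t \<omega> - X s \<omega>) = distr M borel (X (t - s))) \<and>
     (\<forall>s\<ge>0. \<forall>\<epsilon>>0.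
        ((\<lambda>t. measure M {\<omega> \<in> space M. \<epsilon> < \<bar>X t \<omega> - X s \<omega>\<bar>}) \<longlongrightarrow> 0) (at s within {0..}))"

text \<open>The integral formula is the density on the half-line \<open>x > 0\<close>, which carries the whole law.\<close>

definition stable_density :: "real \<Rightarrow> real \<Rightarrow> real \<Rightarrow> real" where
  "stable_density \<alpha> x t =
     (if 0 < x then
        1 / pi * (LBINT y:{0..}. exp (- (x * y)) * exp (- (t * y powr \<alpha> * cos (\<alpha> * pi)))
                      * sin (t * y powr \<alpha> * sin (\<alpha> * pi)))
      else 0)"

definition tempered_stable_density :: "real \<Rightarrow> real \<Rightarrow> real \<Rightarrow> real \<Rightarrow> real" where
  "tempered_stable_density lam \<alpha> x t = exp (- lam * x + lam powr \<alpha> * t) * stable_density \<alpha> x t"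

text \<open>The density is imposed for \<open>t > 0\<close> only, since at time \<open>0\<close> the process is degenerate.\<close>

definition tempered_stable_subordinator ::
    "'a measure \<Rightarrow> real \<Rightarrow> real \<Rightarrow> (real \<Rightarrow> 'a \<Rightarrow> real) \<Rightarrow> bool" where
  "tempered_stable_subordinator M lam \<alpha> S \<longleftrightarrow>
     0 < lam \<and> 0 < \<alpha> \<and> \<alpha> < 1 \<and>
     levy_process M S \<and>
     (\<forall>\<omega>\<in>space M. \<forall>t\<ge>0. 0 \<le> S t \<omega>) \<and>
     (\<forall>\<omega>\<in>space M. \<forall>s t. 0 \<le> s \<and> s \<le> t \<longrightarrow> S s \<omega> \<le> S t \<omega>) \<and>
     (\<forall>t>0. distributed M lborel (S t) (\<lambda>x. ennreal (tempered_stable_density lam \<alpha> x t)))"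

definition time_changed ::
    "(real \<Rightarrow> 'a \<Rightarrow> real) \<Rightarrow> (real \<Rightarrow> 'a \<Rightarrow> real) \<Rightarrow> real \<Rightarrow> 'a \<Rightarrow> real" where
  "time_changed N S t \<omega> = N (S t \<omega>) \<omega>"

definition covariance :: "'a measure \<Rightarrow> ('a \<Rightarrow> real) \<Rightarrow> ('a \<Rightarrow> real) \<Rightarrow> real" where
  "covariance M X Y =
     integral\<^sup>L M (\<lambda>\<omega>. (X \<omega> - integral\<^sup>L M X) * (Y \<omega> - integral\<^sup>L M Y))"

definition correlation :: "'a measure \<Rightarrow> ('a \<Rightarrow> real) \<Rightarrow> ('a \<Rightarrow> real) \<Rightarrow> real" where
  "correlation M X Y = covariance M X Y / sqrt (covariance M X X * covariance M Y Y)"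

text \<open>
  The exponent \<open>d\<close> is common to all \<open>s\<close>. The condition \<open>c s \<noteq> 0\<close> is implicit in asymptotic
  equivalence to \<open>c(s) t\<^sup>-\<^sup>d\<close>; it is explicit here because \<open>\<sim>[at_top]\<close> also relates
  functions that both vanish eventually.
\<close>

definition long_range_dependent :: "'a measure \<Rightarrow> (real \<Rightarrow> 'a \<Rightarrow> real) \<Rightarrow> bool" where
  "long_range_dependent M X \<longleftrightarrow>
     stochastic_process M X \<and>
     (\<forall>t\<ge>0. integrable M (\<lambda>\<omega>. (X t \<omega>)\<^sup>2)) \<and>
     (\<exists>(d :: real) (c :: real \<Rightarrow> real). \<forall>s>0. c s \<noteq> 0 \<and>
        (\<lambda>t. correlation M (X t) (X s)) \<sim>[at_top] (\<lambda>t. c s * t powr (- d)))"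

end

theory Submission
  imports Defs
begin

text \<open>
  Put \<open>p\<^sub>i = 2 H\<^sub>i\<close>. Conditioning on the independent clock \<open>S\<close> turns the second moments of the
  time-changed process into moments of \<open>S\<close>: its variance at \<open>t\<close> is
  \<open>a\<^sup>2 E S(t)^p\<^sub>1 + b\<^sup>2 E S(t)^p\<^sub>2\<close>, and its covariance is a combination of the quantities
  \<open>E (S(t)^p + S(s)^p - (S(t) - S(s))^p) / 2\<close>. Tempering gives \<open>S\<close> second moments, so its mean is
  \<open>\<mu> t\<close> with \<open>\<mu> > 0\<close> and its variance is linear in \<open>t\<close>; hence \<open>S(t) / t \<longlonglongrightarrow> \<mu>\<close> in mean square and
  \<open>E S(t)^p\<close> is asymptotic to \<open>(\<mu> t)^p\<close> for \<open>0 < p \<le> 2\<close>.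
  Since \<open>S(t) - S(s)\<close> is independent of \<open>S(s)\<close> and distributed as \<open>S(t - s)\<close>, the increment
  \<open>E S(t)^p - E S(t - s)^p\<close> tends to \<open>0\<close> if \<open>p < 1\<close>, and is asymptotic to \<open>p \<mu>^p s t^(p-1)\<close> if
  \<open>p \<ge> 1\<close>. So each covariance term is of exact order \<open>t^max 0 (p-1)\<close>, with a positive constant. The
  largest exponent \<open>P\<close> that occurs with a nonzero coefficient wins, and \<open>d = P/2 - max 0 (P - 1)\<close>.
\<close>

subsection \<open>Real powers and asymptotics\<close>

text \<open>The mean value theorem, with \<open>x\<close> positive so that \<open>powr\<close> is
  differentiable on the whole interval. The exponent is left free, so concave and convex powers are
  both covered; the weak inequalities for \<open>z\<close> absorb \<open>y = 0\<close>.\<close>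

lemma powr_increment_bounds:
  fixes x y p :: real
  assumes "0 < x" "0 \<le> y"
  obtains z where "x \<le> z" "z \<le> x + y" "(x + y) powr p - x powr p = p * z powr (p - 1) * y"
proof (cases "y = 0")
  case True
  with assms show ?thesis by (intro that[of x]) auto
next
  case False
  with assms have "x < x + y" by simp
  then obtain z where "z > x" "z < x + y" "(x + y) powr p - x powr p = (x + y - x) * (p * z powr (p - 1))"
    using assms MVT2[of x "x + y" "\<lambda>x. x powr p" "\<lambda>x. p * x powr (p - 1)"]
    by (force intro!: derivative_eq_intros simp: powr_diff)
  then show ?thesis by (intro that[of z]) auto
qed

text \<open>Subadditivity of concave powers: after division by \<open>x + y\<close> both summands
  lie in [0,1], where an exponent of at most 1 can only enlarge a number.\<close>

lemma powr_increment_le: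
  fixes x y p :: real
  assumes "0 < p" "p \<le> 1" "0 \<le> x" "0 \<le> y"
  shows "(x + y) powr p - x powr p \<le> y powr p"
proof (cases "x + y = 0")
  case False
  then have xy: "x + y > 0" using assms by auto
  have *: "z / (x + y) \<le> (z / (x + y)) powr p" if "0 \<le> z" "z \<le> x + y" for z
  proof (cases "z = 0")
    case False
    then have "(z / (x + y)) powr 1 \<le> (z / (x + y)) powr p"
      using that xy assms by (intro powr_mono') auto
    then show ?thesis using that xy by simp
  qed simp
  have "1 = x / (x + y) + y / (x + y)"
    using xy by (simp flip: add_divide_distrib)
  also have "\<dots> \<le> (x / (x + y)) powr p + (y / (x + y)) powr p"
    using *[of x] *[of y] assms by simp
  also have "\<dots> = (x powr p + y powr p) / (x + y) powr p"
    using assms by (simp add: powr_divide add_divide_distrib)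
  finally show ?thesis using xy by (simp add: field_simps)
next
  case True
  then have "x = 0" "y = 0" using assms by auto
  then show ?thesis by simp
qed

text \<open>The derivative of a convex power is increasing, so the mean value point may be moved to
  the left endpoint. At \<open>x = 0\<close> the left side vanishes, since
  \<open>0 powr (p - 1)\<close> is 0.\<close>

lemma powr_increment_ge_linear:
  fixes x y p :: real
  assumes "1 < p" "0 \<le> x" "0 \<le> y"
  shows "p * x powr (p - 1) * y \<le> (x + y) powr p - x powr p"
proof (cases "x = 0")
  case False
  with assms obtain z where "x \<le> z" "(x + y) powr p - x powr p = p * z powr (p - 1) * y"
    by (metis powr_increment_bounds order_less_le)
  moreover have "x powr (p - 1) \<le> z powr (p - 1)"
    using assms \<open>x \<le> z\<close> by (intro powr_mono2) auto
  ultimately show ?thesis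
    using assms by (auto intro!: mult_right_mono mult_left_mono)
qed (use assms in auto)

lemma powr_increment_le_linear:
  fixes x y p :: real
  assumes "1 < p" "0 \<le> x" "0 \<le> y"
  shows "(x + y) powr p - x powr p \<le> p * (x + y) powr (p - 1) * y"
proof (cases "x = 0")
  case True
  have "y powr p = y powr (p - 1) * y"
    using assms by (cases "y = 0") (auto simp: powr_diff)
  moreover have "1 * (y powr (p - 1) * y) \<le> p * (y powr (p - 1) * y)"
    using assms by (intro mult_right_mono) auto
  ultimately show ?thesis
    using True by simp
next
  case False
  with assms obtain z where "x \<le> z" "z \<le> x + y" "(x + y) powr p - x powr p = p * z powr (p - 1) * y"
    by (metis powr_increment_bounds order_less_le)
  moreover have "z powr (p - 1) \<le> (x + y) powr (p - 1)"
    using assms \<open>x \<le> z\<close> \<open>z \<le> x + y\<close> by (intro powr_mono2) auto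
  ultimately show ?thesis
    using assms by (auto intro!: mult_right_mono mult_left_mono)
qed

lemma powr_le_one_plus_square:
  fixes x p :: real
  assumes "0 \<le> x" "0 < p" "p \<le> 2"
  shows "x powr p \<le> 1 + x\<^sup>2"
proof (cases "x \<le> 1")
  case True
  then have "x powr p \<le> 1 powr p" using assms by (intro powr_mono2) auto
  then show ?thesis by (simp add: add_increasing2)
next
  case False
  then have "x powr p \<le> x powr 2" using assms by (intro powr_mono) auto
  also have "\<dots> = x\<^sup>2" using False by (simp add: powr_numeral)
  finally show ?thesis by simp
qed

text \<open>Near \<open>m\<close> continuity gives the error \<open>e\<close>; away from
  \<open>m\<close> the at most quadratic growth is dominated by a multiple of the squared distance.
  Integrated, the bound turns mean square convergence into convergence of \<open>p\<close>-th
  moments.\<close>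

lemma powr_diff_le_square:
  fixes m p e :: real
  assumes "0 < m" "0 < p" "p \<le> 2" "0 < e"
  obtains C where "0 \<le> C" "\<And>x. 0 \<le> x \<Longrightarrow> \<bar>x powr p - m powr p\<bar> \<le> e + C * (x - m)\<^sup>2"
proof -
  have "isCont (\<lambda>x. x powr p) m"
    using assms by (intro continuous_intros) auto
  then obtain d where d: "d > 0" "\<And>x. \<bar>x - m\<bar> < d \<Longrightarrow> \<bar>x powr p - m powr p\<bar> < e"
    using \<open>0 < e\<close> unfolding continuous_at_eps_delta dist_real_def by blast
  \<comment> \<open>The summand \<open>2 * m\<^sup>2\<close> is chosen so that the quadratic
    estimate below reduces to \<open>0 \<le> (x - 2 * m)\<^sup>2\<close>.\<close>
  define K where "K = 1 + m powr p + 2 * m\<^sup>2"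
  have K: "0 \<le> K" by (simp add: K_def)
  show thesis
  proof (rule that[of "2 + K / d\<^sup>2"])
    show "0 \<le> 2 + K / d\<^sup>2" using K by simp
    fix x :: real assume x: "0 \<le> x"
    show "\<bar>x powr p - m powr p\<bar> \<le> e + (2 + K / d\<^sup>2) * (x - m)\<^sup>2"
    proof (cases "\<bar>x - m\<bar> < d")
      case True
      then have "\<bar>x powr p - m powr p\<bar> \<le> e" using d by force
      also have "\<dots> \<le> e + (2 + K / d\<^sup>2) * (x - m)\<^sup>2" using K by simp
      finally show ?thesis .
    next
      case False
      then have "d\<^sup>2 \<le> (x - m)\<^sup>2"
        using d by (metis abs_ge_zero abs_of_pos linorder_not_less power2_abs power_mono order_less_imp_le)
      then have *: "K \<le> K / d\<^sup>2 * (x - m)\<^sup>2"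
        using d K by (simp add: field_simps mult_left_mono)
      have "\<bar>x powr p - m powr p\<bar> \<le> 1 + x\<^sup>2 + m powr p"
        using powr_le_one_plus_square[OF x assms(2,3)] powr_ge_zero[of x p] powr_ge_zero[of m p]
          zero_le_power2[of x] by linarith
      also have "\<dots> \<le> K + 2 * (x - m)\<^sup>2"
        using zero_le_power2[of "x - 2 * m"] by (simp add: K_def power2_eq_square algebra_simps)
      also have "\<dots> \<le> e + (2 + K / d\<^sup>2) * (x - m)\<^sup>2"
        using * \<open>0 < e\<close> by (simp add: algebra_simps)
      finally show ?thesis .
    qed
  qed
qed

text \<open>Separates the growth rates of a covariance (\<open>e\<close>) and of a variance
  (\<open>p\<close>) from the correlation they form; \<open>V\<close> is meant for the variance at
  the fixed earlier time, which carries no rate.\<close>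

lemma divide_powr_sqrt_powr:
  fixes t C V W e p :: real
  assumes "0 < t"
  shows "C / t powr e / sqrt (W / t powr p * V) = C / sqrt (W * V) / t powr - (p / 2 - e)"
proof -
  have "sqrt (t powr p) = t powr (p / 2)"
    using assms by (simp add: powr_half_sqrt[symmetric] powr_powr)
  then have "sqrt (W / t powr p * V) = sqrt (W * V) / t powr (p / 2)"
    by (simp add: real_sqrt_mult real_sqrt_divide)
  moreover have "t powr - (p / 2 - e) = t powr e / t powr (p / 2)"
    by (simp flip: powr_diff)
  ultimately show ?thesis by simp
qed

lemma norm_mult_le_sum_squares:
  fixes x y :: real
  shows "norm (x * y) \<le> norm (x\<^sup>2 + y\<^sup>2)"
proof -
  have "2 * (\<bar>x\<bar> * \<bar>y\<bar>) \<le> x\<^sup>2 + y\<^sup>2"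
    using sum_squares_bound[of "\<bar>x\<bar>" "\<bar>y\<bar>"] by simp
  moreover have "0 \<le> \<bar>x\<bar> * \<bar>y\<bar>" by simp
  ultimately have "\<bar>x\<bar> * \<bar>y\<bar> \<le> x\<^sup>2 + y\<^sup>2" by linarith
  then show ?thesis by (simp add: abs_mult)
qed

text \<open>Cauchy's functional equation, with monotonicity, a consequence of nonnegativity, in
  place of continuity. Squeezing \<open>real n * t\<close> between consecutive integers bounds
  \<open>real n * \<bar>f t - t * f 1\<bar>\<close> by \<open>f 1\<close> for every
  \<open>n\<close>, which forces the difference to be 0.\<close>

lemma nonneg_additive_linear:
  fixes f :: "real \<Rightarrow> real"
  assumes nonneg: "\<And>t. 0 \<le> t \<Longrightarrow> 0 \<le> f t"
    and add: "\<And>s t. 0 \<le> s \<Longrightarrow> 0 \<le> t \<Longrightarrow> f (s + t) = f s + f t"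
    and t: "0 \<le> t"
  shows "f t = t * f 1"
proof -
  have mono: "f s \<le> f t" if "0 \<le> s" "s \<le> t" for s t
    using nonneg[of "t - s"] add[of s "t - s"] that by simp
  have mult: "f (real n * s) = real n * f s" if "0 \<le> s" for n s
  proof (induction n)
    case 0
    then show ?case using add[of 0 0] by simp
  next
    case (Suc n)
    then show ?case using add[of "real n * s" s] that by (simp add: algebra_simps)
  qed
  have f1: "0 \<le> f 1" by (rule nonneg) simp
  have bound: "real n * \<bar>f t - t * f 1\<bar> \<le> f 1" for n
  proof -
    define k where "k = nat \<lfloor>real n * t\<rfloor>"
    have k: "real k \<le> real n * t" "real n * t \<le> real (Suc k)"
      using t unfolding k_def by (auto simp: nat_add_distrib) linarith
    have "real k * f 1 \<le> real n * f t" "real n * f t \<le> real (Suc k) * f 1"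
      using mono[OF _ k(1)] mono[OF _ k(2)] mult[OF t, of n] mult[of 1 k] mult[of 1 "Suc k"] t by auto
    moreover have "real k * f 1 \<le> real n * t * f 1" "real n * t * f 1 \<le> real (Suc k) * f 1"
      using k f1 by (auto intro!: mult_right_mono simp del: of_nat_Suc)
    ultimately have "\<bar>real n * f t - real n * t * f 1\<bar> \<le> f 1"
      by (auto simp: algebra_simps abs_le_iff)
    moreover have "real n * f t - real n * t * f 1 = real n * (f t - t * f 1)"
      by (simp add: algebra_simps)
    ultimately show ?thesis by (simp add: abs_mult)
  qed
  show ?thesis
  proof (rule ccontr)
    assume "f t \<noteq> t * f 1"
    then have "0 < \<bar>f t - t * f 1\<bar>" by simp
    then obtain n where "f 1 < real n * \<bar>f t - t * f 1\<bar>" using reals_Archimedean3 by blast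
    with bound[of n] show False by simp
  qed
qed

text \<open>Nonnegative weights and positive limits exclude cancellation, so the larger exponent
  with a nonzero weight fixes the order. This serves both the variance and the covariance of the
  time-changed process.\<close>

lemma weighted_powr_combination:
  fixes f1 f2 :: "real \<Rightarrow> real"
  assumes "((\<lambda>t. f1 t / t powr e1) \<longlongrightarrow> L1) at_top" "((\<lambda>t. f2 t / t powr e2) \<longlongrightarrow> L2) at_top"
    and "0 < L1" "0 < L2" "e1 \<le> e2" "0 \<le> w1" "0 \<le> w2" "w1 \<noteq> 0 \<or> w2 \<noteq> 0"
  obtains L where "0 < L"
    "((\<lambda>t. (w1 * f1 t + w2 * f2 t) / t powr (if w2 = 0 then e1 else e2)) \<longlongrightarrow> L) at_top"
proof (cases "w2 = 0")
  case True
  show thesis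
    by (rule that[of "w1 * L1"]) (use assms True tendsto_mult_left[OF assms(1), of w1] in auto)
next
  case False
  \<comment> \<open>The limit \<open>l\<close> is 1 for equal exponents, when both terms contribute,
    and 0 otherwise. Its sign is enough for the positivity of the total.\<close>
  obtain l where l: "0 \<le> l" "((\<lambda>t. t powr (e1 - e2)) \<longlongrightarrow> l) at_top"
  proof (cases "e1 = e2")
    case True
    have "((\<lambda>t::real. t powr (e1 - e2)) \<longlongrightarrow> 1) at_top"
      by (rule tendsto_eventually, rule eventually_mono[OF eventually_gt_at_top[of 0]]) (simp add: True)
    then show ?thesis by (intro that[of 1]) auto
  next
    case False
    then have "((\<lambda>t::real. t powr (e1 - e2)) \<longlongrightarrow> 0) at_top"
      using assms by (intro tendsto_neg_powr filterlim_ident) auto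
    then show ?thesis by (intro that[of 0]) auto
  qed
  have "((\<lambda>t. w1 * (f1 t / t powr e1 * t powr (e1 - e2)) + w2 * (f2 t / t powr e2))
          \<longlongrightarrow> w1 * (L1 * l) + w2 * L2) at_top"
    by (intro tendsto_intros assms l)
  moreover have "\<forall>\<^sub>F t in at_top. w1 * (f1 t / t powr e1 * t powr (e1 - e2)) + w2 * (f2 t / t powr e2)
      = (w1 * f1 t + w2 * f2 t) / t powr e2"
    by (rule eventually_mono[OF eventually_gt_at_top[of 0]]) (simp add: powr_diff field_simps)
  ultimately have "((\<lambda>t. (w1 * f1 t + w2 * f2 t) / t powr e2) \<longlongrightarrow> w1 * (L1 * l) + w2 * L2) at_top"
    by (rule Lim_transform_eventually)
  moreover have "0 < w1 * (L1 * l) + w2 * L2"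
    using assms l False by (intro add_nonneg_pos) auto
  ultimately show thesis using False by (intro that) auto
qed

subsection \<open>Square-integrable subordinators\<close>

text \<open>Collects what the moment asymptotics require of the clock. For the tempered stable
  subordinator the density enters only through the last two assumptions.\<close>

locale square_integrable_subordinator = prob_space +
  fixes S :: "real \<Rightarrow> 'a \<Rightarrow> real"
  assumes measurable_S [measurable]: "\<And>t. 0 \<le> t \<Longrightarrow> S t \<in> borel_measurable M"
    and S_nonneg: "\<And>t \<omega>. 0 \<le> t \<Longrightarrow> \<omega> \<in> space M \<Longrightarrow> 0 \<le> S t \<omega>"
    and S_mono: "\<And>s t \<omega>. 0 \<le> s \<Longrightarrow> s \<le> t \<Longrightarrow> \<omega> \<in> space M \<Longrightarrow> S s \<omega> \<le> S t \<omega>"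
    and S_indep: "\<And>s t. 0 \<le> s \<Longrightarrow> s \<le> t \<Longrightarrow> indep_var borel (S s) borel (\<lambda>\<omega>. S t \<omega> - S s \<omega>)"
    and S_stationary: "\<And>s t. 0 \<le> s \<Longrightarrow> s \<le> t \<Longrightarrow>
      distr M borel (\<lambda>\<omega>. S t \<omega> - S s \<omega>) = distr M borel (S (t - s))"
    and integrable_S_square: "\<And>t. 0 \<le> t \<Longrightarrow> integrable M (\<lambda>\<omega>. (S t \<omega>)\<^sup>2)"
    and AE_S_pos: "\<And>t. 0 < t \<Longrightarrow> AE \<omega> in M. 0 < S t \<omega>"
begin

definition "\<mu> = expectation (S 1)"
definition "v = variance (S 1)"

section \<open>First and second moments of the clock\<close>

lemma integrable_S [simp]: "0 \<le> t \<Longrightarrow> integrable M (S t)"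
  using square_integrable_imp_integrable[OF measurable_S integrable_S_square] by simp

lemma integrable_S_powr [simp]:
  assumes "0 \<le> t" "0 < p" "p \<le> 2"
  shows "integrable M (\<lambda>\<omega>. S t \<omega> powr p)"
proof (rule Bochner_Integration.integrable_bound)
  show "integrable M (\<lambda>\<omega>. 1 + (S t \<omega>)\<^sup>2)"
    using integrable_S_square[OF assms(1)] by simp
  show "AE \<omega> in M. norm (S t \<omega> powr p) \<le> norm (1 + (S t \<omega>)\<^sup>2)"
    using assms S_nonneg by (auto simp: powr_le_one_plus_square)
qed (use assms in measurable)

lemma increment_transfer:
  fixes g :: "real \<Rightarrow> real"
  assumes "0 \<le> s" "s \<le> t" and [measurable]: "g \<in> borel_measurable borel"
  shows "integrable M (\<lambda>\<omega>. g (S t \<omega> - S s \<omega>)) \<longleftrightarrow> integrable M (\<lambda>\<omega>. g (S (t - s) \<omega>))"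
    and "expectation (\<lambda>\<omega>. g (S t \<omega> - S s \<omega>)) = expectation (\<lambda>\<omega>. g (S (t - s) \<omega>))"
proof -
  have [measurable]: "S t \<in> borel_measurable M" "S s \<in> borel_measurable M" "S (t - s) \<in> borel_measurable M"
    using assms by simp_all
  show "integrable M (\<lambda>\<omega>. g (S t \<omega> - S s \<omega>)) \<longleftrightarrow> integrable M (\<lambda>\<omega>. g (S (t - s) \<omega>))"
    using S_stationary[OF assms(1,2)]
      integrable_distr_eq[of "\<lambda>\<omega>. S t \<omega> - S s \<omega>" M borel g] integrable_distr_eq[of "S (t - s)" M borel g]
    by simp
  show "expectation (\<lambda>\<omega>. g (S t \<omega> - S s \<omega>)) = expectation (\<lambda>\<omega>. g (S (t - s) \<omega>))"
    using S_stationary[OF assms(1,2)]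
      integral_distr[of "\<lambda>\<omega>. S t \<omega> - S s \<omega>" M borel g] integral_distr[of "S (t - s)" M borel g]
    by simp
qed

text \<open>Independence factors the expectation, and stationarity then replaces the increment by
  the clock at \<open>t - s\<close>, so later estimates involve one-time moments only.\<close>

lemma increment_product:
  fixes f g :: "real \<Rightarrow> real"
  assumes "0 \<le> s" "s \<le> t" and [measurable]: "f \<in> borel_measurable borel" "g \<in> borel_measurable borel"
    and f: "integrable M (\<lambda>\<omega>. f (S s \<omega>))" and g: "integrable M (\<lambda>\<omega>. g (S (t - s) \<omega>))"
  shows "integrable M (\<lambda>\<omega>. f (S s \<omega>) * g (S t \<omega> - S s \<omega>))"
    and "expectation (\<lambda>\<omega>. f (S s \<omega>) * g (S t \<omega> - S s \<omega>)) =
      expectation (\<lambda>\<omega>. f (S s \<omega>)) * expectation (\<lambda>\<omega>. g (S (t - s) \<omega>))"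
proof -
  have indep: "indep_var borel (\<lambda>\<omega>. f (S s \<omega>)) borel (\<lambda>\<omega>. g (S t \<omega> - S s \<omega>))"
    using indep_var_compose[OF S_indep[OF assms(1,2)] assms(3,4)] by (simp add: comp_def)
  have g': "integrable M (\<lambda>\<omega>. g (S t \<omega> - S s \<omega>))"
    using g increment_transfer(1)[OF assms(1,2,4)] by simp
  show "integrable M (\<lambda>\<omega>. f (S s \<omega>) * g (S t \<omega> - S s \<omega>))"
    by (rule indep_var_integrable[OF indep f g'])
  show "expectation (\<lambda>\<omega>. f (S s \<omega>) * g (S t \<omega> - S s \<omega>)) =
      expectation (\<lambda>\<omega>. f (S s \<omega>)) * expectation (\<lambda>\<omega>. g (S (t - s) \<omega>))"
    using indep_var_lebesgue_integral[OF indep f g'] increment_transfer(2)[OF assms(1,2,4)] by simp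
qed

text \<open>Stationary increments make the mean additive in time, and nonnegativity then makes it
  linear.\<close>

lemma expectation_S:
  assumes "0 \<le> t"
  shows "expectation (S t) = \<mu> * t"
proof -
  have "expectation (S (s + t)) = expectation (S s) + expectation (S t)" if "0 \<le> s" "0 \<le> t" for s t
    using that increment_transfer(2)[of s "s + t" "\<lambda>x. x"] by simp
  moreover have "0 \<le> expectation (S t)" if "0 \<le> t" for t
    using that S_nonneg by (intro integral_nonneg_AE) auto
  ultimately show ?thesis
    using nonneg_additive_linear[of "\<lambda>t. expectation (S t)" t] assms by (simp add: \<mu>_def)
qed

text \<open>Independent increments make the variance additive, hence equal to \<open>v * t\<close>;
  the squared mean is the remaining summand.\<close>

lemma expectation_S_square:
  assumes "0 \<le> t"
  shows "expectation (\<lambda>\<omega>. (S t \<omega>)\<^sup>2) = v * t + (\<mu> * t)\<^sup>2"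
proof -
  have var: "variance (S t) = expectation (\<lambda>\<omega>. (S t \<omega>)\<^sup>2) - (\<mu> * t)\<^sup>2" if "0 \<le> t" for t
    using that integrable_S_square[OF that] by (subst variance_eq) (simp_all add: expectation_S)
  have "variance (S (s + t)) = variance (S s) + variance (S t)" if "0 \<le> s" "0 \<le> t" for s t
  proof -
    have prod: "integrable M (\<lambda>\<omega>. S s \<omega> * (S (s + t) \<omega> - S s \<omega>))"
      "expectation (\<lambda>\<omega>. S s \<omega> * (S (s + t) \<omega> - S s \<omega>)) = (\<mu> * s) * (\<mu> * t)"
      using increment_product[of s "s + t" "\<lambda>x. x" "\<lambda>x. x"] that expectation_S by simp_all
    have sq: "integrable M (\<lambda>\<omega>. (S (s + t) \<omega> - S s \<omega>)\<^sup>2)"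
      "expectation (\<lambda>\<omega>. (S (s + t) \<omega> - S s \<omega>)\<^sup>2) = expectation (\<lambda>\<omega>. (S t \<omega>)\<^sup>2)"
      using increment_transfer[of s "s + t" "\<lambda>x. x\<^sup>2"] that integrable_S_square by simp_all
    have "expectation (\<lambda>\<omega>. (S (s + t) \<omega>)\<^sup>2) =
        expectation (\<lambda>\<omega>. (S s \<omega>)\<^sup>2 + 2 * (S s \<omega> * (S (s + t) \<omega> - S s \<omega>)) + (S (s + t) \<omega> - S s \<omega>)\<^sup>2)"
      by (intro Bochner_Integration.integral_cong) (auto simp: power2_eq_square algebra_simps)
    also have "\<dots> = expectation (\<lambda>\<omega>. (S s \<omega>)\<^sup>2) + 2 * ((\<mu> * s) * (\<mu> * t)) + expectation (\<lambda>\<omega>. (S t \<omega>)\<^sup>2)"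
      using prod sq integrable_S_square[OF that(1)] by simp
    finally show ?thesis
      using that by (simp add: var) (simp add: power2_eq_square algebra_simps)
  qed
  then have "variance (S t) = t * v"
    using nonneg_additive_linear[of "\<lambda>t. variance (S t)" t] assms variance_positive by (simp add: v_def)
  then show ?thesis
    using var[OF assms] by (simp add: algebra_simps)
qed

lemma mean_pos: "0 < \<mu>"
proof -
  have "expectation (S 1) \<noteq> 0"
  proof
    assume "expectation (S 1) = 0"
    then have "AE \<omega> in M. S 1 \<omega> = 0"
      using integral_nonneg_eq_0_iff_AE[of M "S 1"] S_nonneg by simp
    with AE_S_pos[OF zero_less_one] have "AE \<omega> in M. False" by eventually_elim simp
    then show False by simp
  qed
  moreover have "0 \<le> expectation (S 1)"
    using S_nonneg by (intro integral_nonneg_AE) auto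
  ultimately show ?thesis by (simp add: \<mu>_def)
qed

lemma powr_moment_pos:
  assumes "0 < t" "0 < p" "p \<le> 2"
  shows "0 < expectation (\<lambda>\<omega>. S t \<omega> powr p)"
proof -
  have "expectation (\<lambda>\<omega>. S t \<omega> powr p) \<noteq> 0"
  proof
    assume "expectation (\<lambda>\<omega>. S t \<omega> powr p) = 0"
    then have "AE \<omega> in M. S t \<omega> powr p = 0"
      using integral_nonneg_eq_0_iff_AE[of M "\<lambda>\<omega>. S t \<omega> powr p"] assms by simp
    with AE_S_pos[OF assms(1)] have "AE \<omega> in M. False" by eventually_elim simp
    then show False by simp
  qed
  moreover have "0 \<le> expectation (\<lambda>\<omega>. S t \<omega> powr p)"
    by (intro integral_nonneg_AE) auto
  ultimately show ?thesis by (metis order_less_le)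
qed

text \<open>A law of large numbers with the rate \<open>v / t\<close>. The limit of the power
  moments and the control of an untypically slow clock both rest on it.\<close>

lemma mean_square_deviation:
  assumes "0 < t"
  shows "integrable M (\<lambda>\<omega>. (S t \<omega> / t - \<mu>)\<^sup>2)"
    and "expectation (\<lambda>\<omega>. (S t \<omega> / t - \<mu>)\<^sup>2) = v / t"
proof -
  have eq: "(S t \<omega> / t - \<mu>)\<^sup>2 = (S t \<omega>)\<^sup>2 / t\<^sup>2 - 2 * \<mu> / t * S t \<omega> + \<mu>\<^sup>2" for \<omega>
    by (simp add: power2_diff power_divide)
  show "integrable M (\<lambda>\<omega>. (S t \<omega> / t - \<mu>)\<^sup>2)"
    using integrable_S_square[of t] assms by (simp add: eq)
  have "expectation (\<lambda>\<omega>. (S t \<omega> / t - \<mu>)\<^sup>2) = (v * t + (\<mu> * t)\<^sup>2) / t\<^sup>2 - 2 * \<mu> / t * (\<mu> * t) + \<mu>\<^sup>2"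
    using integrable_S_square[of t] assms by (simp add: eq expectation_S expectation_S_square prob_space)
  also have "\<dots> = v / t"
    using assms by (simp add: field_simps power2_eq_square)
  finally show "expectation (\<lambda>\<omega>. (S t \<omega> / t - \<mu>)\<^sup>2) = v / t" .
qed

section \<open>Power moments of the clock at large times and their increments\<close>

lemma mean_square_deviation_tendsto: "((\<lambda>t. v / t) \<longlongrightarrow> 0) at_top"
  by (intro tendsto_divide_0[OF tendsto_const] filterlim_at_top_imp_at_infinity filterlim_ident)

text \<open>Integrating \<open>powr_diff_le_square\<close> for the rescaled clock
  \<open>S t / t\<close> leaves an error of at most \<open>e / 2 + C * (v / t)\<close>, where
  \<open>C\<close> depends on \<open>e\<close> but not on \<open>t\<close>.\<close>

lemma powr_moment_asymp:
  assumes p: "0 < p" "p \<le> 2"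
  shows "((\<lambda>t. expectation (\<lambda>\<omega>. S t \<omega> powr p) / t powr p) \<longlongrightarrow> \<mu> powr p) at_top"
proof (rule tendstoI)
  fix e :: real assume "0 < e"
  then have "0 < e / 2" by simp
  from powr_diff_le_square[OF mean_pos p this] obtain C where C: "0 \<le> C"
    "\<And>x. 0 \<le> x \<Longrightarrow> \<bar>x powr p - \<mu> powr p\<bar> \<le> e / 2 + C * (x - \<mu>)\<^sup>2" by blast
  have "((\<lambda>t. C * (v / t)) \<longlongrightarrow> C * 0) at_top"
    by (intro tendsto_intros mean_square_deviation_tendsto)
  then have "\<forall>\<^sub>F t in at_top. C * (v / t) < e / 2"
    using \<open>0 < e\<close> by (intro order_tendstoD(2)) auto
  with eventually_gt_at_top[of 0]
  show "\<forall>\<^sub>F t in at_top. dist (expectation (\<lambda>\<omega>. S t \<omega> powr p) / t powr p) (\<mu> powr p) < e"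
  proof eventually_elim
    case (elim t)
    have int: "integrable M (\<lambda>\<omega>. (S t \<omega> / t) powr p - \<mu> powr p)"
      using p elim S_nonneg by (subst Bochner_Integration.integrable_cong[OF refl,
        where g = "\<lambda>\<omega>. S t \<omega> powr p / t powr p - \<mu> powr p"]) (auto simp: powr_divide)
    have "expectation (\<lambda>\<omega>. S t \<omega> powr p) / t powr p - \<mu> powr p
        = expectation (\<lambda>\<omega>. S t \<omega> powr p / t powr p - \<mu> powr p)"
      using p elim by (simp add: prob_space)
    also have "\<dots> = expectation (\<lambda>\<omega>. (S t \<omega> / t) powr p - \<mu> powr p)"
      using elim S_nonneg by (intro Bochner_Integration.integral_cong) (auto simp: powr_divide)
    also have "\<bar>\<dots>\<bar> \<le> expectation (\<lambda>\<omega>. e / 2 + C * (S t \<omega> / t - \<mu>)\<^sup>2)"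
      using int C elim S_nonneg mean_square_deviation[of t]
      by (intro order_trans[OF integral_abs_bound] integral_mono) auto
    also have "\<dots> = e / 2 + C * (v / t)"
      using mean_square_deviation[of t] elim by (simp add: prob_space)
    finally show ?case using elim unfolding dist_real_def by linarith
  qed
qed

text \<open>The shift by a fixed \<open>s\<close> costs only the factor
  \<open>(1 - s / t) powr p\<close>, which tends to 1.\<close>

lemma powr_moment_asymp_shift:
  assumes p: "0 < p" "p \<le> 2"
  shows "((\<lambda>t. expectation (\<lambda>\<omega>. S (t - s) \<omega> powr p) / t powr p) \<longlongrightarrow> \<mu> powr p) at_top"
proof -
  have shift: "filterlim (\<lambda>t::real. t - s) at_top at_top"
    using filterlim_tendsto_add_at_top[OF tendsto_const[of "-s"] filterlim_ident] by (simp add: add.commute)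
  have "((\<lambda>t. s / t) \<longlongrightarrow> 0) at_top"
    by (intro tendsto_divide_0[OF tendsto_const] filterlim_at_top_imp_at_infinity filterlim_ident)
  then have "((\<lambda>t. (1 - s / t) powr p) \<longlongrightarrow> (1 - 0) powr p) at_top"
    by (intro tendsto_powr tendsto_intros) auto
  from tendsto_mult[OF filterlim_compose[OF powr_moment_asymp[OF p] shift] this]
  have "((\<lambda>t. expectation (\<lambda>\<omega>. S (t - s) \<omega> powr p) / (t - s) powr p * (1 - s / t) powr p)
      \<longlongrightarrow> \<mu> powr p) at_top" by simp
  moreover have "\<forall>\<^sub>F t in at_top. expectation (\<lambda>\<omega>. S (t - s) \<omega> powr p) / (t - s) powr p * (1 - s / t) powr p
     = expectation (\<lambda>\<omega>. S (t - s) \<omega> powr p) / t powr p"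
    using eventually_gt_at_top[of "max 0 s"]
  proof eventually_elim
    case (elim t)
    then have "1 - s / t = (t - s) / t" by (simp add: field_simps)
    with elim show ?case by (simp add: powr_divide)
  qed
  ultimately show ?thesis by (rule Lim_transform_eventually)
qed

text \<open>Two cases according to the clock at time \<open>t - s\<close>. If it has reached half of
  its mean, the mean value theorem applies with a derivative that tends to 0. If it lags behind,
  subadditivity bounds the increment, and the mean square deviation makes this case
  negligible.\<close>

lemma powr_moment_increment_sublinear:
  assumes p: "0 < p" "p < 1" and s: "0 \<le> s"
  shows "((\<lambda>t. expectation (\<lambda>\<omega>. S t \<omega> powr p) - expectation (\<lambda>\<omega>. S (t - s) \<omega> powr p)) \<longlongrightarrow> 0) at_top"
proof -
  let ?d = "\<lambda>t \<omega>. S t \<omega> powr p - S (t - s) \<omega> powr p"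
  \<comment> \<open>The first summand comes from the typical clock, the second from the slow
    one.\<close>
  let ?b = "\<lambda>t. p * (\<mu> / 2 * (t - s)) powr (p - 1) * (\<mu> * s)
      + 4 / \<mu>\<^sup>2 * (v / (t - s)) * expectation (\<lambda>\<omega>. S s \<omega> powr p)"
  have shift: "filterlim (\<lambda>t::real. t - s) at_top at_top"
    using filterlim_tendsto_add_at_top[OF tendsto_const[of "-s"] filterlim_ident] by (simp add: add.commute)
  have "((\<lambda>t. (\<mu> / 2 * (t - s)) powr (p - 1)) \<longlongrightarrow> 0) at_top"
    using p mean_pos
    by (intro tendsto_neg_powr filterlim_tendsto_pos_mult_at_top[OF tendsto_const _ shift]) auto
  moreover have "((\<lambda>t. v / (t - s)) \<longlongrightarrow> 0) at_top"
    by (rule filterlim_compose[OF mean_square_deviation_tendsto shift])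
  ultimately have "(?b \<longlongrightarrow> p * 0 * (\<mu> * s) + 4 / \<mu>\<^sup>2 * 0 * expectation (\<lambda>\<omega>. S s \<omega> powr p)) at_top"
    by (intro tendsto_intros)
  then have lim: "(?b \<longlongrightarrow> 0) at_top" by simp
  show ?thesis
  proof (rule tendsto_sandwich[OF _ _ tendsto_const lim])
    show "\<forall>\<^sub>F t in at_top. 0 \<le> expectation (\<lambda>\<omega>. S t \<omega> powr p) - expectation (\<lambda>\<omega>. S (t - s) \<omega> powr p)"
      using eventually_ge_at_top[of "max s 0"]
    proof eventually_elim
      case (elim t)
      have "expectation (\<lambda>\<omega>. S (t - s) \<omega> powr p) \<le> expectation (\<lambda>\<omega>. S t \<omega> powr p)"
        using p s elim S_nonneg S_mono by (intro integral_mono powr_mono2) auto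
      then show ?case by simp
    qed
    show "\<forall>\<^sub>F t in at_top. expectation (\<lambda>\<omega>. S t \<omega> powr p) - expectation (\<lambda>\<omega>. S (t - s) \<omega> powr p) \<le> ?b t"
      using eventually_gt_at_top[of "max s 0"]
    proof eventually_elim
      case (elim t)
      define u where "u = t - s"
      have u: "0 < u" "u \<le> t" "t - u = s" "t = u + s" using elim s by (auto simp: u_def)
      let ?x = "\<lambda>\<omega>. S u \<omega>" and ?y = "\<lambda>\<omega>. S t \<omega> - S u \<omega>"
      have prod: "integrable M (\<lambda>\<omega>. (?x \<omega> / u - \<mu>)\<^sup>2 * ?y \<omega> powr p)"
        "expectation (\<lambda>\<omega>. (?x \<omega> / u - \<mu>)\<^sup>2 * ?y \<omega> powr p) = v / u * expectation (\<lambda>\<omega>. S s \<omega> powr p)"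
        using increment_product[of u t "\<lambda>x. (x / u - \<mu>)\<^sup>2" "\<lambda>x. x powr p"]
          mean_square_deviation[of u] u s p by simp_all
      \<comment> \<open>Both error terms are nonnegative, so their sum covers both cases pointwise
        and no indicator of the slow event is needed.\<close>
      have bound: "?x \<omega> powr p + p * (\<mu> / 2 * u) powr (p - 1) * ?y \<omega>
          + 4 / \<mu>\<^sup>2 * ((?x \<omega> / u - \<mu>)\<^sup>2 * ?y \<omega> powr p) \<ge> S t \<omega> powr p"
        if \<omega>: "\<omega> \<in> space M" for \<omega>
      proof -
        have nn: "0 \<le> ?x \<omega>" "0 \<le> ?y \<omega>" using \<omega> u s S_nonneg[of u] S_mono[of u t] by auto
        show ?thesis
        proof (cases "\<mu> / 2 * u \<le> ?x \<omega>")
          case True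
          have pos: "0 < \<mu> / 2 * u" using mean_pos u by simp
          then have "0 < ?x \<omega>" using True by linarith
          then obtain z where z: "?x \<omega> \<le> z" "(?x \<omega> + ?y \<omega>) powr p - ?x \<omega> powr p = p * z powr (p - 1) * ?y \<omega>"
            using powr_increment_bounds[OF _ nn(2)] by blast
          have "z powr (p - 1) \<le> (\<mu> / 2 * u) powr (p - 1)"
            using p pos z True by (intro powr_mono2') auto
          then have "p * z powr (p - 1) * ?y \<omega> \<le> p * (\<mu> / 2 * u) powr (p - 1) * ?y \<omega>"
            using p nn by (intro mult_right_mono mult_left_mono) auto
          moreover have "0 \<le> 4 / \<mu>\<^sup>2 * ((?x \<omega> / u - \<mu>)\<^sup>2 * ?y \<omega> powr p)" by simp
          ultimately show ?thesis using z(2) unfolding diff_add_cancel add.commute[of "?x \<omega>" "?y \<omega>"] by linarith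
        next
          case False
          then have "?x \<omega> / u < \<mu> / 2" using u by (simp add: field_simps)
          then have "(\<mu> / 2)\<^sup>2 \<le> (\<mu> - ?x \<omega> / u)\<^sup>2"
            using mean_pos by (intro power_mono) auto
          \<comment> \<open>Chebyshev's inequality in pointwise form: the squared deviation, a
            function of \<open>S u\<close>, plays the part of the indicator and is independent of
            the increment that it multiplies.\<close>
          then have "1 \<le> 4 / \<mu>\<^sup>2 * (?x \<omega> / u - \<mu>)\<^sup>2"
            using mean_pos by (simp add: power2_commute field_simps)
          then have "1 * ?y \<omega> powr p \<le> 4 / \<mu>\<^sup>2 * (?x \<omega> / u - \<mu>)\<^sup>2 * ?y \<omega> powr p"
            by (intro mult_right_mono) auto
          moreover have "(?x \<omega> + ?y \<omega>) powr p - ?x \<omega> powr p \<le> ?y \<omega> powr p"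
            using p nn by (intro powr_increment_le) auto
          moreover have "0 \<le> p * (\<mu> / 2 * u) powr (p - 1) * ?y \<omega>" using p nn by simp
          ultimately show ?thesis by simp
        qed
      qed
      have "expectation (\<lambda>\<omega>. S t \<omega> powr p) \<le> expectation (\<lambda>\<omega>. ?x \<omega> powr p + p * (\<mu> / 2 * u) powr (p - 1) * ?y \<omega>
          + 4 / \<mu>\<^sup>2 * ((?x \<omega> / u - \<mu>)\<^sup>2 * ?y \<omega> powr p))"
        using p u s prod(1) by (intro integral_mono bound) auto
      also have "\<dots> = expectation (\<lambda>\<omega>. ?x \<omega> powr p) + p * (\<mu> / 2 * u) powr (p - 1) * (\<mu> * s)
          + 4 / \<mu>\<^sup>2 * (v / u * expectation (\<lambda>\<omega>. S s \<omega> powr p))"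
        using p u s prod by (simp add: expectation_S algebra_simps)
      finally show ?case by (simp add: u_def)
    qed
  qed
qed

text \<open>Here the long increment \<open>S t - S s\<close>, distributed as
  \<open>S (t - s)\<close>, is the base point and \<open>S s\<close> is the perturbation. The two
  linear bounds for convex powers differ in expectation by at most a constant, which is negligible
  against \<open>t powr (p - 1)\<close>; independence evaluates the common main term.\<close>

lemma powr_moment_increment_superlinear:
  assumes p: "1 < p" "p \<le> 2" and s: "0 \<le> s"
  shows "((\<lambda>t. (expectation (\<lambda>\<omega>. S t \<omega> powr p) - expectation (\<lambda>\<omega>. S (t - s) \<omega> powr p)) / t powr (p - 1))
    \<longlongrightarrow> p * \<mu> powr (p - 1) * (\<mu> * s)) at_top"
proof -
  let ?m = "\<lambda>t. expectation (\<lambda>\<omega>. S (t - s) \<omega> powr (p - 1))"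
  let ?r = "expectation (\<lambda>\<omega>. S s \<omega> powr (p - 1) * S s \<omega>)"
  have q: "0 < p - 1" "p - 1 \<le> 2" using p by auto
  \<comment> \<open>The product form is the one that the upper bound produces; it agrees with the
    power also where \<open>S s\<close> is 0.\<close>
  have self: "S s \<omega> powr (p - 1) * S s \<omega> = S s \<omega> powr p" if "\<omega> \<in> space M" for \<omega>
    using S_nonneg[OF s that] by (cases "S s \<omega> = 0") (auto simp: powr_diff)
  have int_r: "integrable M (\<lambda>\<omega>. S s \<omega> powr (p - 1) * S s \<omega>)"
    using s p by (subst Bochner_Integration.integrable_cong[OF refl self]) auto
  have "((\<lambda>t::real. t powr - (p - 1)) \<longlongrightarrow> 0) at_top"
    using q by (intro tendsto_neg_powr filterlim_ident) auto
  then have small: "((\<lambda>t::real. inverse (t powr (p - 1))) \<longlongrightarrow> 0) at_top"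
    by (simp only: powr_minus)
  have lower: "((\<lambda>t. p * (?m t / t powr (p - 1)) * (\<mu> * s)) \<longlongrightarrow> p * \<mu> powr (p - 1) * (\<mu> * s)) at_top"
    by (intro tendsto_intros powr_moment_asymp_shift q)
  have "((\<lambda>t. p * (?m t / t powr (p - 1)) * (\<mu> * s) + p * ?r * inverse (t powr (p - 1)))
      \<longlongrightarrow> p * \<mu> powr (p - 1) * (\<mu> * s) + p * ?r * 0) at_top"
    by (intro tendsto_intros powr_moment_asymp_shift q small)
  then have upper: "((\<lambda>t. p * (?m t / t powr (p - 1)) * (\<mu> * s) + p * ?r * inverse (t powr (p - 1)))
      \<longlongrightarrow> p * \<mu> powr (p - 1) * (\<mu> * s)) at_top" by simp
  have bounds: "p * ?m t * (\<mu> * s) \<le> expectation (\<lambda>\<omega>. S t \<omega> powr p) - expectation (\<lambda>\<omega>. S (t - s) \<omega> powr p)"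
    "expectation (\<lambda>\<omega>. S t \<omega> powr p) - expectation (\<lambda>\<omega>. S (t - s) \<omega> powr p) \<le> p * ?m t * (\<mu> * s) + p * ?r"
    if t: "s \<le> t" for t
  proof -
    let ?x = "\<lambda>\<omega>. S t \<omega> - S s \<omega>" and ?y = "\<lambda>\<omega>. S s \<omega>"
    have nn: "0 \<le> ?x \<omega>" "0 \<le> ?y \<omega>" if "\<omega> \<in> space M" for \<omega>
      using that s t S_nonneg[of s] S_mono[of s t] by auto
    have prod: "integrable M (\<lambda>\<omega>. ?y \<omega> * ?x \<omega> powr (p - 1))"
      "expectation (\<lambda>\<omega>. ?y \<omega> * ?x \<omega> powr (p - 1)) = \<mu> * s * ?m t"
      using increment_product[of s t "\<lambda>x. x" "\<lambda>x. x powr (p - 1)"] q s t expectation_S by simp_all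
    have inc: "integrable M (\<lambda>\<omega>. ?x \<omega> powr p)"
      "expectation (\<lambda>\<omega>. ?x \<omega> powr p) = expectation (\<lambda>\<omega>. S (t - s) \<omega> powr p)"
      using increment_transfer[of s t "\<lambda>x. x powr p"] p s t by simp_all
    have t0: "0 \<le> t" using s t by simp
    have "p * ?m t * (\<mu> * s) = expectation (\<lambda>\<omega>. p * (?y \<omega> * ?x \<omega> powr (p - 1)))"
      using prod by simp
    also have "\<dots> \<le> expectation (\<lambda>\<omega>. S t \<omega> powr p - ?x \<omega> powr p)"
    proof (rule integral_mono)
      show "p * (?y \<omega> * ?x \<omega> powr (p - 1)) \<le> S t \<omega> powr p - ?x \<omega> powr p" if "\<omega> \<in> space M" for \<omega>
        using powr_increment_ge_linear[OF p(1) nn[OF that]] by (simp add: mult_ac)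
    qed (use prod inc p t0 in auto)
    also have diff: "expectation (\<lambda>\<omega>. S t \<omega> powr p - ?x \<omega> powr p)
        = expectation (\<lambda>\<omega>. S t \<omega> powr p) - expectation (\<lambda>\<omega>. S (t - s) \<omega> powr p)"
      using inc p t0 by simp
    finally show "p * ?m t * (\<mu> * s) \<le> expectation (\<lambda>\<omega>. S t \<omega> powr p) - expectation (\<lambda>\<omega>. S (t - s) \<omega> powr p)" .
    have "expectation (\<lambda>\<omega>. S t \<omega> powr p - ?x \<omega> powr p)
        \<le> expectation (\<lambda>\<omega>. p * (?y \<omega> * ?x \<omega> powr (p - 1)) + p * (?y \<omega> powr (p - 1) * ?y \<omega>))"
    proof (rule integral_mono)
      fix \<omega> assume \<omega>: "\<omega> \<in> space M"
      \<comment> \<open>The exponent \<open>p - 1\<close> lies in (0,1], so subadditivity splits off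
        a remainder that depends on \<open>S s\<close> alone.\<close>
      have "(?x \<omega> + ?y \<omega>) powr (p - 1) \<le> ?x \<omega> powr (p - 1) + ?y \<omega> powr (p - 1)"
        using powr_increment_le[of "p - 1" "?x \<omega>" "?y \<omega>"] p nn[OF \<omega>] by simp
      then have "p * (?x \<omega> + ?y \<omega>) powr (p - 1) * ?y \<omega> \<le> p * (?x \<omega> powr (p - 1) + ?y \<omega> powr (p - 1)) * ?y \<omega>"
        using p nn[OF \<omega>] by (intro mult_right_mono mult_left_mono) auto
      then show "S t \<omega> powr p - ?x \<omega> powr p \<le> p * (?y \<omega> * ?x \<omega> powr (p - 1)) + p * (?y \<omega> powr (p - 1) * ?y \<omega>)"
        using powr_increment_le_linear[OF p(1) nn[OF \<omega>]] by (simp add: algebra_simps)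
    qed (use prod inc p t0 int_r in auto)
    also have "\<dots> = p * ?m t * (\<mu> * s) + p * ?r"
      using prod int_r by simp
    finally show "expectation (\<lambda>\<omega>. S t \<omega> powr p) - expectation (\<lambda>\<omega>. S (t - s) \<omega> powr p) \<le> p * ?m t * (\<mu> * s) + p * ?r"
      using diff by simp
  qed
  show ?thesis
  proof (rule tendsto_sandwich[OF _ _ lower upper])
    show "\<forall>\<^sub>F t in at_top. p * (?m t / t powr (p - 1)) * (\<mu> * s)
      \<le> (expectation (\<lambda>\<omega>. S t \<omega> powr p) - expectation (\<lambda>\<omega>. S (t - s) \<omega> powr p)) / t powr (p - 1)"
      using eventually_gt_at_top[of "max s 0"]
    proof eventually_elim
      case (elim t)
      then show ?case using divide_right_mono[OF bounds(1)[of t], of "t powr (p - 1)"] by simp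
    qed
    show "\<forall>\<^sub>F t in at_top. (expectation (\<lambda>\<omega>. S t \<omega> powr p) - expectation (\<lambda>\<omega>. S (t - s) \<omega> powr p)) / t powr (p - 1)
      \<le> p * (?m t / t powr (p - 1)) * (\<mu> * s) + p * ?r * inverse (t powr (p - 1))"
      using eventually_gt_at_top[of "max s 0"]
    proof eventually_elim
      case (elim t)
      have "(p * ?m t * (\<mu> * s) + p * ?r) / t powr (p - 1)
          = p * (?m t / t powr (p - 1)) * (\<mu> * s) + p * ?r * inverse (t powr (p - 1))"
        using elim by (simp add: field_simps)
      then show ?case using elim divide_right_mono[OF bounds(2)[of t], of "t powr (p - 1)"] by simp
    qed
  qed
qed

text \<open>The expectation is the positive constant \<open>k\<close> plus the moment increment
  \<open>d t\<close>. For \<open>p < 1\<close> the constant survives alone, for \<open>p = 1\<close>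
  the increment is exactly \<open>\<mu> * s\<close>, and for \<open>p > 1\<close> the increment
  dominates.\<close>

lemma powr_moment_kernel_asymp:
  assumes p: "0 < p" "p \<le> 2" and s: "0 < s"
  obtains L where "0 < L"
    "((\<lambda>t. expectation (\<lambda>\<omega>. S t \<omega> powr p + S s \<omega> powr p - (S t \<omega> - S s \<omega>) powr p) / t powr max 0 (p - 1))
      \<longlongrightarrow> L) at_top"
proof -
  define k where "k = expectation (\<lambda>\<omega>. S s \<omega> powr p)"
  define d where "d t = expectation (\<lambda>\<omega>. S t \<omega> powr p) - expectation (\<lambda>\<omega>. S (t - s) \<omega> powr p)" for t
  have k: "0 < k" using p s by (simp add: k_def powr_moment_pos)
  have split: "\<forall>\<^sub>F t in at_top. (k + d t) / t powr e
      = expectation (\<lambda>\<omega>. S t \<omega> powr p + S s \<omega> powr p - (S t \<omega> - S s \<omega>) powr p) / t powr e" for e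
    using eventually_ge_at_top[of s]
  proof eventually_elim
    case (elim t)
    then show ?case
      using increment_transfer[of s t "\<lambda>x. x powr p"] p s by (simp add: k_def d_def)
  qed
  consider "p < 1" | "p = 1" | "1 < p" by linarith
  then obtain L where L: "0 < L" "((\<lambda>t. (k + d t) / t powr max 0 (p - 1)) \<longlongrightarrow> L) at_top"
  proof cases
    case 1
    have "((\<lambda>t. k + d t) \<longlongrightarrow> k + 0) at_top"
      unfolding d_def using 1 p s by (intro tendsto_intros powr_moment_increment_sublinear) auto
    then have "((\<lambda>t. k + d t) \<longlongrightarrow> k) at_top" by simp
    moreover have "\<forall>\<^sub>F t in at_top. k + d t = (k + d t) / t powr max 0 (p - 1)"
      using eventually_gt_at_top[of 0] by eventually_elim (use 1 in \<open>simp add: max_def\<close>)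
    ultimately have "((\<lambda>t. (k + d t) / t powr max 0 (p - 1)) \<longlongrightarrow> k) at_top"
      by (rule Lim_transform_eventually)
    with k show ?thesis by (rule that)
  next
    case 2
    have "\<forall>\<^sub>F t in at_top. k + \<mu> * s = (k + d t) / t powr max 0 (p - 1)"
      using eventually_gt_at_top[of s]
    proof eventually_elim
      case (elim t)
      \<comment> \<open>At exponent 1 the simplified powers appear as absolute values, which
        nonnegativity of the clock removes.\<close>
      have *: "expectation (\<lambda>\<omega>. \<bar>S u \<omega>\<bar>) = \<mu> * u" if "0 \<le> u" for u
        using expectation_S[OF that] S_nonneg[OF that]
          Bochner_Integration.integral_cong[of M M "\<lambda>\<omega>. \<bar>S u \<omega>\<bar>" "S u"] by simp
      show ?case using elim 2 s by (simp add: d_def * algebra_simps)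
    qed
    then have "((\<lambda>t. (k + d t) / t powr max 0 (p - 1)) \<longlongrightarrow> k + \<mu> * s) at_top"
      by (rule Lim_transform_eventually[OF tendsto_const])
    then show ?thesis using k mean_pos s by (intro that[of "k + \<mu> * s"]) (auto intro: add_pos_nonneg)
  next
    case 3
    have "((\<lambda>t::real. t powr - (p - 1)) \<longlongrightarrow> 0) at_top"
      using 3 by (intro tendsto_neg_powr filterlim_ident) auto
    then have "((\<lambda>t. k * t powr - (p - 1) + d t / t powr (p - 1)) \<longlongrightarrow> k * 0 + p * \<mu> powr (p - 1) * (\<mu> * s)) at_top"
      unfolding d_def using 3 p s by (intro tendsto_intros powr_moment_increment_superlinear) auto
    then have "((\<lambda>t. (k + d t) / t powr max 0 (p - 1)) \<longlongrightarrow> p * \<mu> powr (p - 1) * (\<mu> * s)) at_top"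
      using 3 unfolding powr_minus_divide by (simp add: add_divide_distrib)
    then show ?thesis using 3 mean_pos s by (intro that[of "p * \<mu> powr (p - 1) * (\<mu> * s)"]) auto
  qed
  show thesis by (rule that[OF L(1) Lim_transform_eventually[OF L(2) split]])
qed

end

subsection \<open>Independent time changes\<close>

text \<open>Rounding time down to a grid of mesh \<open>1 / Suc n\<close> gives countably many time
  values, hence a jointly measurable map; path continuity passes this to the limit.\<close>

lemma measurable_continuous_process:
  fixes Y :: "real \<Rightarrow> 'a \<Rightarrow> real"
  assumes Y: "\<And>t. 0 \<le> t \<Longrightarrow> Y t \<in> borel_measurable F"
    and cont: "\<And>\<omega>. \<omega> \<in> space F \<Longrightarrow> continuous_on {0..} (\<lambda>t. Y t \<omega>)"
  shows "(\<lambda>(\<omega>, t). Y (max 0 t) \<omega>) \<in> borel_measurable (F \<Otimes>\<^sub>M borel)"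
proof -
  \<comment> \<open>\<open>nat\<close> sends negative times to the grid point 0, in agreement with
    \<open>max 0 t\<close>.\<close>
  define k where "k n t = nat \<lfloor>real (Suc n) * t\<rfloor>" for n t
  let ?Y = "\<lambda>n (x :: 'a \<times> real). Y (real (k n (snd x)) / real (Suc n)) (fst x)"
  have k_meas: "(\<lambda>x. k n (snd x)) \<in> measurable (F \<Otimes>\<^sub>M borel) (count_space UNIV)" for n
    unfolding k_def by measurable
  have Y_meas: "?Y n \<in> borel_measurable (F \<Otimes>\<^sub>M borel)" for n
  proof (rule measurable_compose_countable[OF _ k_meas])
    show "(\<lambda>x. Y (real i / real (Suc n)) (fst x)) \<in> borel_measurable (F \<Otimes>\<^sub>M borel)" for i
      using Y[of "real i / real (Suc n)"] by measurable
  qed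
  have k_lim: "(\<lambda>n. real (k n t) / real (Suc n)) \<longlonglongrightarrow> max 0 t" for t
  proof (rule tendsto_sandwich)
    have b: "max 0 t * real (Suc n) - 1 \<le> real (k n t)" "real (k n t) \<le> max 0 t * real (Suc n)" for n
    proof -
      have r: "max 0 t * real (Suc n) = max 0 (real (Suc n) * t)"
        by (cases "0 \<le> t")
          (auto simp: max_def mult.commute mult_le_0_iff zero_le_mult_iff simp del: of_nat_Suc)
      have "max 0 r - 1 \<le> real (nat \<lfloor>r\<rfloor>) \<and> real (nat \<lfloor>r\<rfloor>) \<le> max 0 r" for r :: real
      proof (cases "0 \<le> r")
        case True
        then have "real (nat \<lfloor>r\<rfloor>) = of_int \<lfloor>r\<rfloor>" by simp
        then show ?thesis using True by linarith
      qed simp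
      then show "max 0 t * real (Suc n) - 1 \<le> real (k n t)" "real (k n t) \<le> max 0 t * real (Suc n)"
        unfolding r k_def by blast+
    qed
    show "\<forall>\<^sub>F n in sequentially. max 0 t - 1 / real (Suc n) \<le> real (k n t) / real (Suc n)"
    proof (intro always_eventually allI)
      show "max 0 t - 1 / real (Suc n) \<le> real (k n t) / real (Suc n)" for n
        using divide_right_mono[OF b(1)[of n], of "real (Suc n)"]
        by (simp add: diff_divide_distrib del: of_nat_Suc)
    qed
    show "\<forall>\<^sub>F n in sequentially. real (k n t) / real (Suc n) \<le> max 0 t"
      using b(2) by (intro always_eventually allI) (simp add: pos_divide_le_eq del: of_nat_Suc)
    show "(\<lambda>n. max 0 t - 1 / real (Suc n)) \<longlonglongrightarrow> max 0 t"
      using tendsto_diff[OF tendsto_const LIMSEQ_inverse_real_of_nat, of "max 0 t"]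
      by (simp add: inverse_eq_divide)
  qed simp
  show ?thesis
  proof (rule borel_measurable_LIMSEQ_real[OF _ Y_meas])
    fix x assume "x \<in> space (F \<Otimes>\<^sub>M (borel :: real measure))"
    then have "fst x \<in> space F" by (auto simp: space_pair_measure)
    then have "(\<lambda>n. ?Y n x) \<longlonglongrightarrow> Y (max 0 (snd x)) (fst x)"
      by (intro continuous_on_tendsto_compose[OF cont k_lim]) auto
    then show "(\<lambda>n. ?Y n x) \<longlonglongrightarrow> (case x of (\<omega>, t) \<Rightarrow> Y (max 0 t) \<omega>)"
      by (simp add: case_prod_beta)
  qed
qed

text \<open>Fubini for the joint law, pulled back to \<open>M\<close> with the second variable
  frozen. Assuming the product form of that law lets \<open>X\<close> be the identity map into a
  smaller sigma-algebra. The version for nonnegative integrals is what establishes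
  integrability.\<close>

lemma (in prob_space)
  fixes g :: "'b \<Rightarrow> 'c \<Rightarrow> real"
  assumes [measurable]: "random_variable P X" "random_variable Q Y"
    and joint: "distr M P X \<Otimes>\<^sub>M distr M Q Y = distr M (P \<Otimes>\<^sub>M Q) (\<lambda>\<omega>. (X \<omega>, Y \<omega>))"
    and g [measurable]: "case_prod g \<in> borel_measurable (P \<Otimes>\<^sub>M Q)"
  shows expectation_product_law: "integrable M (\<lambda>\<omega>. g (X \<omega>) (Y \<omega>)) \<Longrightarrow>
      expectation (\<lambda>\<omega>. g (X \<omega>) (Y \<omega>)) = expectation (\<lambda>\<omega>'. expectation (\<lambda>\<omega>. g (X \<omega>) (Y \<omega>')))"
    and nn_integral_product_law: "(\<integral>\<^sup>+\<omega>. ennreal (g (X \<omega>) (Y \<omega>)) \<partial>M) =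
      (\<integral>\<^sup>+\<omega>'. (\<integral>\<^sup>+\<omega>. ennreal (g (X \<omega>) (Y \<omega>')) \<partial>M) \<partial>M)"
proof -
  interpret X: prob_space "distr M P X" by (rule prob_space_distr) measurable
  interpret Y: prob_space "distr M Q Y" by (rule prob_space_distr) measurable
  interpret XY: pair_sigma_finite "distr M P X" "distr M Q Y" ..
  have g': "case_prod g \<in> borel_measurable (distr M P X \<Otimes>\<^sub>M distr M Q Y)"
    by simp
  have sect: "(\<lambda>x. g x (Y \<omega>')) \<in> borel_measurable P" if "\<omega>' \<in> space M" for \<omega>'
  proof -
    have "Y \<omega>' \<in> space Q" using that by (meson \<open>random_variable Q Y\<close> measurable_space)
    then show ?thesis by measurable
  qed
  show "expectation (\<lambda>\<omega>. g (X \<omega>) (Y \<omega>)) = expectation (\<lambda>\<omega>'. expectation (\<lambda>\<omega>. g (X \<omega>) (Y \<omega>')))"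
    if int: "integrable M (\<lambda>\<omega>. g (X \<omega>) (Y \<omega>))"
  proof -
    have int': "integrable (distr M P X \<Otimes>\<^sub>M distr M Q Y) (case_prod g)"
      unfolding joint by (subst integrable_distr_eq) (use int in \<open>auto simp: case_prod_beta\<close>)
    have "expectation (\<lambda>\<omega>. g (X \<omega>) (Y \<omega>)) = integral\<^sup>L (distr M P X \<Otimes>\<^sub>M distr M Q Y) (case_prod g)"
      unfolding joint by (subst integral_distr) auto
    also have "\<dots> = (\<integral>y. (\<integral>x. g x y \<partial>distr M P X) \<partial>distr M Q Y)"
      by (rule XY.integral_snd[OF int', symmetric])
    also have "\<dots> = expectation (\<lambda>\<omega>'. \<integral>x. g x (Y \<omega>') \<partial>distr M P X)"
      by (subst integral_distr) auto
    also have "\<dots> = expectation (\<lambda>\<omega>'. expectation (\<lambda>\<omega>. g (X \<omega>) (Y \<omega>')))"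
      by (intro Bochner_Integration.integral_cong refl integral_distr sect) auto
    finally show ?thesis .
  qed
  have "(\<integral>\<^sup>+\<omega>. ennreal (g (X \<omega>) (Y \<omega>)) \<partial>M)
      = (\<integral>\<^sup>+z. ennreal (case_prod g z) \<partial>(distr M P X \<Otimes>\<^sub>M distr M Q Y))"
    unfolding joint by (subst nn_integral_distr) auto
  also have "\<dots> = (\<integral>\<^sup>+y. (\<integral>\<^sup>+x. ennreal (g x y) \<partial>distr M P X) \<partial>distr M Q Y)"
    by (subst XY.nn_integral_snd[symmetric]) auto
  also have "\<dots> = (\<integral>\<^sup>+\<omega>'. (\<integral>\<^sup>+x. ennreal (g x (Y \<omega>')) \<partial>distr M P X) \<partial>M)"
    by (subst nn_integral_distr) auto
  also have "\<dots> = (\<integral>\<^sup>+\<omega>'. (\<integral>\<^sup>+\<omega>. ennreal (g (X \<omega>) (Y \<omega>')) \<partial>M) \<partial>M)"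
    by (intro nn_integral_cong nn_integral_distr) (use sect in auto)
  finally show "(\<integral>\<^sup>+\<omega>. ennreal (g (X \<omega>) (Y \<omega>)) \<partial>M) =
      (\<integral>\<^sup>+\<omega>'. (\<integral>\<^sup>+\<omega>. ennreal (g (X \<omega>) (Y \<omega>')) \<partial>M) \<partial>M)" .
qed

text \<open>\<open>F\<close> holds the information of the outer process and \<open>G\<close> that of
  the clock, both on the sample space of \<open>M\<close>.\<close>

locale independent_time_change = prob_space +
  fixes F G :: "'a measure" and Y :: "real \<Rightarrow> 'a \<Rightarrow> real"
  assumes space_F: "space F = space M" and space_G: "space G = space M"
    and indep_FG: "indep_set (sets F) (sets G)"
    and Y_measurable: "\<And>t. 0 \<le> t \<Longrightarrow> Y t \<in> borel_measurable F"
    and Y_continuous: "\<And>\<omega>. \<omega> \<in> space M \<Longrightarrow> continuous_on {0..} (\<lambda>t. Y t \<omega>)"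
    and Y_mean: "\<And>t. 0 \<le> t \<Longrightarrow> expectation (Y t) = 0"
    and Y_square: "\<And>t. 0 \<le> t \<Longrightarrow> integrable M (\<lambda>\<omega>. (Y t \<omega>)\<^sup>2)"
begin

lemma measurable_F: "f \<in> measurable F N \<Longrightarrow> f \<in> measurable M N"
  using measurable_mono[OF order_refl refl indep_setD_ev1[OF indep_FG] space_F] by auto

lemma measurable_G: "f \<in> measurable G N \<Longrightarrow> f \<in> measurable M N"
  using measurable_mono[OF order_refl refl indep_setD_ev2[OF indep_FG] space_G] by auto

text \<open>The identity map into \<open>F\<close> represents the whole outer process as one random
  element.\<close>

lemma measurable_id: "(\<lambda>\<omega>. \<omega>) \<in> measurable M F"
  by (rule measurable_F) simp

text \<open>It suffices to compare rectangles. The preimage of \<open>A\<close> under the identity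
  is \<open>A\<close> itself, so the claim becomes independence of an event of \<open>F\<close> and
  an event of \<open>G\<close>.\<close>

lemma clock_joint_law:
  assumes U: "U \<in> measurable G Q"
  shows "distr M F (\<lambda>\<omega>. \<omega>) \<Otimes>\<^sub>M distr M Q U = distr M (F \<Otimes>\<^sub>M Q) (\<lambda>\<omega>. (\<omega>, U \<omega>))"
proof (rule pair_measure_eqI)
  note [measurable] = measurable_id measurable_G[OF U]
  show "sigma_finite_measure (distr M F (\<lambda>\<omega>. \<omega>))" "sigma_finite_measure (distr M Q U)"
    by (auto intro!: prob_space_imp_sigma_finite prob_space_distr)
  fix A B assume "A \<in> sets (distr M F (\<lambda>\<omega>. \<omega>))" "B \<in> sets (distr M Q U)"
  then have [measurable]: "A \<in> sets F" "B \<in> sets Q" by auto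
  have "U -` B \<inter> space M \<in> sets G"
    using measurable_sets[OF U \<open>B \<in> sets Q\<close>] by (simp add: space_G)
  then have "prob (A \<inter> (U -` B \<inter> space M)) = prob A * prob (U -` B \<inter> space M)"
    using indep_FG \<open>A \<in> sets F\<close> by (simp add: indep_sets2_eq)
  moreover have "A \<subseteq> space M"
    using sets.sets_into_space[OF \<open>A \<in> sets F\<close>] by (simp add: space_F)
  then have "(\<lambda>\<omega>. \<omega>) -` A \<inter> space M = A" "(\<lambda>\<omega>. (\<omega>, U \<omega>)) -` (A \<times> B) \<inter> space M = A \<inter> (U -` B \<inter> space M)"
    by auto
  ultimately show "emeasure (distr M F (\<lambda>\<omega>. \<omega>)) A * emeasure (distr M Q U) B =
      emeasure (distr M (F \<Otimes>\<^sub>M Q) (\<lambda>\<omega>. (\<omega>, U \<omega>))) (A \<times> B)"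
    by (simp add: emeasure_distr emeasure_eq_measure flip: ennreal_mult)
qed (simp cong: sets_pair_measure_cong)

lemma measurable_time_change:
  assumes T: "T \<in> borel_measurable G" "\<And>\<omega>. \<omega> \<in> space M \<Longrightarrow> 0 \<le> T \<omega>"
  shows "(\<lambda>\<omega>. Y (T \<omega>) \<omega>) \<in> borel_measurable M"
proof -
  have "(\<lambda>\<omega>. (\<omega>, T \<omega>)) \<in> measurable M (F \<Otimes>\<^sub>M borel)"
    using measurable_id measurable_G[OF T(1)] by (rule measurable_Pair)
  from measurable_compose[OF this measurable_continuous_process[of Y F]]
  have "(\<lambda>\<omega>. Y (max 0 (T \<omega>)) \<omega>) \<in> borel_measurable M"
    using Y_measurable Y_continuous space_F by auto
  then show ?thesis
    by (subst measurable_cong[where g = "\<lambda>\<omega>. Y (max 0 (T \<omega>)) \<omega>"]) (use T in auto)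
qed

text \<open>Tonelli: the second moment is the average over the clock of the second moments at frozen
  times.\<close>

lemma integrable_time_change_square:
  assumes T: "T \<in> borel_measurable G" "\<And>\<omega>. \<omega> \<in> space M \<Longrightarrow> 0 \<le> T \<omega>"
    and int: "integrable M (\<lambda>\<omega>. expectation (\<lambda>\<omega>'. (Y (T \<omega>) \<omega>')\<^sup>2))"
  shows "integrable M (\<lambda>\<omega>. (Y (T \<omega>) \<omega>)\<^sup>2)"
proof (rule integrableI_nonneg)
  have [measurable]: "(\<lambda>(\<omega>, t). Y (max 0 t) \<omega>) \<in> borel_measurable (F \<Otimes>\<^sub>M borel)"
    using Y_measurable Y_continuous space_F by (intro measurable_continuous_process) auto
  show "(\<lambda>\<omega>. (Y (T \<omega>) \<omega>)\<^sup>2) \<in> borel_measurable M"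
    using measurable_time_change[OF T] by measurable
  have "(\<integral>\<^sup>+\<omega>. ennreal ((Y (T \<omega>) \<omega>)\<^sup>2) \<partial>M) = (\<integral>\<^sup>+\<omega>. ennreal ((Y (max 0 (T \<omega>)) \<omega>)\<^sup>2) \<partial>M)"
    using T by (intro nn_integral_cong) auto
  also have "\<dots> = (\<integral>\<^sup>+\<omega>'. (\<integral>\<^sup>+\<omega>. ennreal ((Y (max 0 (T \<omega>')) \<omega>)\<^sup>2) \<partial>M) \<partial>M)"
    by (rule nn_integral_product_law[OF measurable_id measurable_G[OF T(1)] clock_joint_law[OF T(1)]]) measurable
  also have "\<dots> = (\<integral>\<^sup>+\<omega>'. ennreal (expectation (\<lambda>\<omega>. (Y (T \<omega>') \<omega>)\<^sup>2)) \<partial>M)"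
    using T by (intro nn_integral_cong) (simp add: nn_integral_eq_integral Y_square)
  also have "\<dots> < \<infinity>"
    using int by (subst nn_integral_eq_integral) auto
  finally show "(\<integral>\<^sup>+\<omega>. ennreal ((Y (T \<omega>) \<omega>)\<^sup>2) \<partial>M) < \<infinity>" .
qed simp

lemma expectation_time_change:
  assumes T: "T \<in> borel_measurable G" "\<And>\<omega>. \<omega> \<in> space M \<Longrightarrow> 0 \<le> T \<omega>"
    and int: "integrable M (\<lambda>\<omega>. expectation (\<lambda>\<omega>'. (Y (T \<omega>) \<omega>')\<^sup>2))"
  shows "expectation (\<lambda>\<omega>. Y (T \<omega>) \<omega>) = 0"
proof -
  have m: "(\<lambda>(\<omega>, t). Y (max 0 t) \<omega>) \<in> borel_measurable (F \<Otimes>\<^sub>M borel)"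
    using Y_measurable Y_continuous space_F by (intro measurable_continuous_process) auto
  have "integrable M (\<lambda>\<omega>. Y (T \<omega>) \<omega>)"
    using square_integrable_imp_integrable[OF measurable_time_change[OF T]
        integrable_time_change_square[OF T int]] .
  then have "integrable M (\<lambda>\<omega>. Y (max 0 (T \<omega>)) \<omega>)"
    by (rule Bochner_Integration.integrable_cong[THEN iffD1, OF refl, rotated]) (use T in auto)
  from expectation_product_law[OF measurable_id measurable_G[OF T(1)] clock_joint_law[OF T(1)] m this]
  have "expectation (\<lambda>\<omega>. Y (max 0 (T \<omega>)) \<omega>) = expectation (\<lambda>\<omega>'. expectation (Y (max 0 (T \<omega>'))))" .
  then show ?thesis
    using T Bochner_Integration.integral_cong[of M M "\<lambda>\<omega>. Y (T \<omega>) \<omega>" "\<lambda>\<omega>. Y (max 0 (T \<omega>)) \<omega>"]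
    by (simp add: Y_mean)
qed

lemma expectation_time_change_product:
  assumes T: "T \<in> borel_measurable G" "\<And>\<omega>. \<omega> \<in> space M \<Longrightarrow> 0 \<le> T \<omega>"
    and intT: "integrable M (\<lambda>\<omega>. expectation (\<lambda>\<omega>'. (Y (T \<omega>) \<omega>')\<^sup>2))"
    and U: "U \<in> borel_measurable G" "\<And>\<omega>. \<omega> \<in> space M \<Longrightarrow> 0 \<le> U \<omega>"
    and intU: "integrable M (\<lambda>\<omega>. expectation (\<lambda>\<omega>'. (Y (U \<omega>) \<omega>')\<^sup>2))"
  shows "expectation (\<lambda>\<omega>. Y (T \<omega>) \<omega> * Y (U \<omega>) \<omega>) =
    expectation (\<lambda>\<omega>. expectation (\<lambda>\<omega>'. Y (T \<omega>) \<omega>' * Y (U \<omega>) \<omega>'))"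
proof -
  let ?g = "\<lambda>\<omega> (t, u). Y (max 0 t) \<omega> * Y (max 0 u) \<omega>"
  have [measurable]: "(\<lambda>(\<omega>, t). Y (max 0 t) \<omega>) \<in> borel_measurable (F \<Otimes>\<^sub>M borel)"
    using Y_measurable Y_continuous space_F by (intro measurable_continuous_process) auto
  \<comment> \<open>The two clock values form one random element of the plane, so a single use of
    the joint law freezes both.\<close>
  have TU: "(\<lambda>\<omega>. (T \<omega>, U \<omega>)) \<in> measurable G (borel \<Otimes>\<^sub>M borel)"
    using T(1) U(1) by (rule measurable_Pair)
  have m: "case_prod ?g \<in> borel_measurable (F \<Otimes>\<^sub>M (borel \<Otimes>\<^sub>M borel))"
    by (simp add: case_prod_beta) measurable
  have "integrable M (\<lambda>\<omega>. Y (T \<omega>) \<omega> * Y (U \<omega>) \<omega>)"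
  proof (rule Bochner_Integration.integrable_bound)
    show "integrable M (\<lambda>\<omega>. (Y (T \<omega>) \<omega>)\<^sup>2 + (Y (U \<omega>) \<omega>)\<^sup>2)"
      using integrable_time_change_square[OF T intT] integrable_time_change_square[OF U intU] by simp
    show "(\<lambda>\<omega>. Y (T \<omega>) \<omega> * Y (U \<omega>) \<omega>) \<in> borel_measurable M"
      using measurable_time_change[OF T] measurable_time_change[OF U] by measurable
    show "AE \<omega> in M. norm (Y (T \<omega>) \<omega> * Y (U \<omega>) \<omega>) \<le> norm ((Y (T \<omega>) \<omega>)\<^sup>2 + (Y (U \<omega>) \<omega>)\<^sup>2)"
      by (intro AE_I2 norm_mult_le_sum_squares)
  qed
  then have "integrable M (\<lambda>\<omega>. ?g \<omega> (T \<omega>, U \<omega>))"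
    by (rule Bochner_Integration.integrable_cong[THEN iffD1, OF refl, rotated]) (use T U in auto)
  from expectation_product_law[OF measurable_id measurable_G[OF TU] clock_joint_law[OF TU] m this]
  have "expectation (\<lambda>\<omega>. ?g \<omega> (T \<omega>, U \<omega>)) = expectation (\<lambda>\<omega>'. expectation (\<lambda>\<omega>. ?g \<omega> (T \<omega>', U \<omega>')))" .
  moreover have "expectation (\<lambda>\<omega>. ?g \<omega> (T \<omega>, U \<omega>)) = expectation (\<lambda>\<omega>. Y (T \<omega>) \<omega> * Y (U \<omega>) \<omega>)"
    using T U by (intro Bochner_Integration.integral_cong) auto
  moreover have "expectation (\<lambda>\<omega>'. expectation (\<lambda>\<omega>. ?g \<omega> (T \<omega>', U \<omega>'))) =
      expectation (\<lambda>\<omega>. expectation (\<lambda>\<omega>'. Y (T \<omega>) \<omega>' * Y (U \<omega>) \<omega>'))"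
    using T U by (intro Bochner_Integration.integral_cong) auto
  ultimately show ?thesis by simp
qed

end

subsection \<open>Tempered stable subordinators\<close>

text \<open>Up to the factor \<open>l\<close> this is the exponential density, whose total mass is
  1.\<close>

lemma integrable_exp_half_line:
  fixes l :: real
  assumes "0 < l"
  shows "integrable lborel (\<lambda>x. indicator {0..} x * exp (- (l * x)))"
proof -
  interpret E: prob_space "density lborel (exponential_density l)"
    by (rule prob_space_exponential_density[OF assms])
  have "(\<integral>\<^sup>+x. ennreal (exponential_density l x) \<partial>lborel) = 1"
    using E.emeasure_space_1 by (simp add: emeasure_density)
  then have "integrable lborel (exponential_density l)"
    using assms by (intro integrableI_nonneg) (auto simp: exponential_density_def)
  then have "integrable lborel (\<lambda>x. exponential_density l x / l)" by simp
  moreover have "exponential_density l x / l = indicator {0..} x * exp (- (l * x))" for x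
    using assms by (simp add: exponential_density_def indicator_def mult.commute)
  ultimately show ?thesis by simp
qed

lemma powr_sublinear:
  fixes t \<alpha> :: real
  assumes "0 < t" "0 < \<alpha>" "\<alpha> < 1"
  obtains K where "\<And>y. 0 \<le> y \<Longrightarrow> t * y powr \<alpha> \<le> y / 2 + K"
proof (rule that)
  \<comment> \<open>\<open>?R\<close> is the crossover at which \<open>t * y powr \<alpha>\<close>
    equals \<open>y / 2\<close>; beyond it the linear term wins, and before it the power is at most
    its value there.\<close>
  let ?R = "(2 * t) powr (1 / (1 - \<alpha>))"
  fix y :: real assume y: "0 \<le> y"
  show "t * y powr \<alpha> \<le> y / 2 + t * ?R powr \<alpha>"
  proof (cases "y \<le> ?R")
    case True
    then have "y powr \<alpha> \<le> ?R powr \<alpha>" using y assms by (intro powr_mono2) auto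
    then have "t * y powr \<alpha> \<le> t * ?R powr \<alpha>" using assms by (intro mult_left_mono) auto
    then show ?thesis using y by simp
  next
    case False
    have "0 < ?R" using assms by simp
    with False have y0: "0 < y" by linarith
    have "?R powr (1 - \<alpha>) \<le> y powr (1 - \<alpha>)"
      using False assms by (intro powr_mono2) auto
    moreover have "?R powr (1 - \<alpha>) = 2 * t"
      using assms by (simp add: powr_powr)
    ultimately have "2 * t * y powr \<alpha> \<le> y powr (1 - \<alpha>) * y powr \<alpha>"
      by (intro mult_right_mono) auto
    also have "\<dots> = y" using y0 by (simp flip: powr_add)
    finally have "t * y powr \<alpha> \<le> y / 2" by simp
    moreover have "0 \<le> t * ?R powr \<alpha>" using assms by simp
    ultimately show ?thesis by linarith
  qed
qed

text \<open>For \<open>x \<ge> 1\<close> the factor \<open>exp (- (x * y))\<close> is at most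
  \<open>exp (- y)\<close>. Half of this decay absorbs the growth that occurs when the cosine is
  negative, leaving an integrable majorant independent of \<open>x\<close>.\<close>

lemma stable_density_bounded:
  fixes t \<alpha> :: real
  assumes "0 < t" "0 < \<alpha>" "\<alpha> < 1"
  obtains C where "0 \<le> C" "\<And>x. 1 \<le> x \<Longrightarrow> stable_density \<alpha> x t \<le> C"
proof -
  obtain K where K: "\<And>y. 0 \<le> y \<Longrightarrow> t * y powr \<alpha> \<le> y / 2 + K"
    using powr_sublinear[OF assms] by blast
  let ?b = "\<lambda>y::real. exp K * (indicator {0..} y * exp (- (1 / 2 * y)))"
  have b: "integrable lborel ?b"
    by (intro integrable_mult_right integrable_exp_half_line) simp
  have b0: "0 \<le> integral\<^sup>L lborel ?b"
    by (intro integral_nonneg_AE) auto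
  show thesis
  proof (rule that)
    show "0 \<le> 1 / pi * integral\<^sup>L lborel ?b" using b0 by simp
    fix x :: real assume x: "1 \<le> x"
    let ?f = "\<lambda>y::real. indicator {0..} y *\<^sub>R (exp (- (x * y)) * exp (- (t * y powr \<alpha> * cos (\<alpha> * pi)))
                      * sin (t * y powr \<alpha> * sin (\<alpha> * pi)))"
    have bound: "norm (?f y) \<le> ?b y" for y
    proof (cases "0 \<le> y")
      case True
      have "- (t * y powr \<alpha> * cos (\<alpha> * pi)) \<le> t * y powr \<alpha> * 1"
        unfolding mult_minus_right[symmetric] using assms cos_ge_minus_one[of "\<alpha> * pi"]
        by (intro mult_left_mono) auto
      moreover have "1 * y \<le> x * y" using x True by (intro mult_right_mono)
      ultimately have "- (x * y) + - (t * y powr \<alpha> * cos (\<alpha> * pi)) \<le> K + - (1 / 2 * y)"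
        using K[OF True] by linarith
      then have e: "exp (- (x * y)) * exp (- (t * y powr \<alpha> * cos (\<alpha> * pi))) \<le> exp K * exp (- (1 / 2 * y))"
        unfolding exp_add[symmetric] by (simp only: exp_le_cancel_iff)
      have "exp (- (x * y)) * exp (- (t * y powr \<alpha> * cos (\<alpha> * pi))) * \<bar>sin (t * y powr \<alpha> * sin (\<alpha> * pi))\<bar>
          \<le> exp K * exp (- (1 / 2 * y)) * 1"
        by (rule mult_mono[OF e]) auto
      then show ?thesis using True by (simp add: abs_mult)
    qed simp
    have "integral\<^sup>L lborel ?f \<le> integral\<^sup>L lborel ?b"
    proof (cases "integrable lborel ?f")
      case True
      show ?thesis
        by (intro integral_mono[OF True b]) (use bound in \<open>auto simp: abs_le_iff\<close>)
    next
      \<comment> \<open>A nonintegrable function has integral 0 by default, so the bound holds here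
        as well.\<close>
      case False
      then show ?thesis using b0 by (simp add: not_integrable_integral_eq)
    qed
    then show "stable_density \<alpha> x t \<le> 1 / pi * integral\<^sup>L lborel ?b"
      unfolding stable_density_def set_lebesgue_integral_def using x by (simp add: divide_right_mono)
  qed
qed

text \<open>Values in [0,1] contribute at most 1 to the square. On the tail the stable density is
  bounded, and the tempering factor absorbs \<open>x\<^sup>2\<close> with half of its decay to
  spare.\<close>

lemma (in prob_space) tempered_stable_second_moment:
  assumes X: "distributed M lborel X (\<lambda>x. ennreal (tempered_stable_density l \<alpha> x t))"
    and "0 < l" "0 < \<alpha>" "\<alpha> < 1" "0 < t" and nonneg: "\<And>\<omega>. \<omega> \<in> space M \<Longrightarrow> 0 \<le> X \<omega>"
  shows "integrable M (\<lambda>\<omega>. (X \<omega>)\<^sup>2)"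
proof -
  have [measurable]: "X \<in> borel_measurable M"
    using distributed_measurable[OF X] by simp
  obtain C where C: "0 \<le> C" "\<And>x. 1 \<le> x \<Longrightarrow> stable_density \<alpha> x t \<le> C"
    using stable_density_bounded[OF \<open>0 < t\<close> \<open>0 < \<alpha>\<close> \<open>\<alpha> < 1\<close>] by blast
  \<comment> \<open>The factor \<open>8 / l\<^sup>2\<close> stems from
    \<open>z\<^sup>2 / 2 \<le> exp z\<close> at \<open>z = l / 2 * x\<close>.\<close>
  define D where "D = exp (l powr \<alpha> * t) * C * (8 / l\<^sup>2)"
  let ?b = "\<lambda>x::real. D * (indicator {0..} x * exp (- (l / 2 * x)))"
  have D: "0 \<le> D" using C by (simp add: D_def)
  have b: "integrable lborel ?b"
    using \<open>0 < l\<close> by (intro integrable_mult_right integrable_exp_half_line) simp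
  have dens: "ennreal (tempered_stable_density l \<alpha> x t) * ennreal (indicator {1..} x * x\<^sup>2) \<le> ennreal (?b x)" for x
  proof (cases "1 \<le> x")
    case True
    have "(l / 2 * x)\<^sup>2 / 2 \<le> exp (l / 2 * x)"
    proof -
      have "0 \<le> l / 2 * x" using True \<open>0 < l\<close> by simp
      then show ?thesis using exp_lower_Taylor_quadratic[of "l / 2 * x"] by linarith
    qed
    then have x2: "x\<^sup>2 \<le> 8 / l\<^sup>2 * exp (l / 2 * x)"
      using \<open>0 < l\<close> by (simp add: field_simps power2_eq_square)
    have "tempered_stable_density l \<alpha> x t * x\<^sup>2 \<le> exp (- l * x + l powr \<alpha> * t) * C * x\<^sup>2"
      unfolding tempered_stable_density_def using C True by (intro mult_right_mono mult_left_mono) auto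
    also have "\<dots> \<le> exp (- l * x + l powr \<alpha> * t) * C * (8 / l\<^sup>2 * exp (l / 2 * x))"
      using x2 C by (intro mult_left_mono) auto
    also have "\<dots> = D * (exp (- l * x) * exp (l / 2 * x))"
      by (simp only: D_def exp_add mult_ac)
    also have "\<dots> = ?b x"
      using True by (simp flip: exp_add)
    finally show ?thesis
      using True by (simp flip: ennreal_mult'' add: ennreal_leI)
  qed simp
  have "(\<integral>\<^sup>+\<omega>. ennreal (indicator {1..} (X \<omega>) * (X \<omega>)\<^sup>2) \<partial>M) =
      (\<integral>\<^sup>+x. ennreal (tempered_stable_density l \<alpha> x t) * ennreal (indicator {1..} x * x\<^sup>2) \<partial>lborel)"
    by (rule distributed_nn_integral[OF X, symmetric]) simp
  also have "\<dots> \<le> (\<integral>\<^sup>+x. ennreal (?b x) \<partial>lborel)"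
    by (intro nn_integral_mono dens)
  also have "\<dots> < \<infinity>"
    using b D by (subst nn_integral_eq_integral) auto
  finally have "integrable M (\<lambda>\<omega>. indicator {1..} (X \<omega>) * (X \<omega>)\<^sup>2)"
    by (intro integrableI_nonneg) auto
  then have int: "integrable M (\<lambda>\<omega>. 1 + indicator {1..} (X \<omega>) * (X \<omega>)\<^sup>2)" by simp
  show ?thesis
  proof (rule Bochner_Integration.integrable_bound[OF int])
    show "AE \<omega> in M. norm ((X \<omega>)\<^sup>2) \<le> norm (1 + indicator {1..} (X \<omega>) * (X \<omega>)\<^sup>2)"
      using nonneg by (intro AE_I2) (auto simp: indicator_def power_le_one)
  qed simp
qed

text \<open>Points are Lebesgue null. Together with nonnegativity this makes the clock strictly
  positive at positive times.\<close>

lemma (in prob_space) distributed_lborel_AE_neq: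
  fixes X :: "'a \<Rightarrow> 'b::euclidean_space"
  assumes X: "distributed M lborel X f"
  shows "AE \<omega> in M. X \<omega> \<noteq> c"
proof -
  have [measurable]: "X \<in> borel_measurable M"
    using distributed_measurable[OF X] by simp
  have "emeasure M (X -` {c} \<inter> space M) = (\<integral>\<^sup>+x. f x * indicator {c} x \<partial>lborel)"
    by (rule distributed_emeasure[OF X]) simp
  also have "\<dots> = (\<integral>\<^sup>+x. 0 \<partial>(lborel :: 'b measure))"
    using AE_lborel_singleton[of c] by (intro nn_integral_cong_AE) (auto elim!: eventually_mono)
  finally have "emeasure M (X -` {c} \<inter> space M) = 0" by simp
  then show ?thesis
    by (intro AE_I[of _ _ "X -` {c} \<inter> space M"]) auto
qed

text \<open>Independence of increments along the grid 0, \<open>s\<close>, \<open>t\<close>, where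
  the first increment is almost surely \<open>X s\<close>.\<close>

lemma (in prob_space) levy_process_indep_increment:
  assumes X: "levy_process M X" and st: "0 \<le> s" "s \<le> t"
  shows "indep_var borel (X s) borel (\<lambda>\<omega>. X t \<omega> - X s \<omega>)"
proof -
  have meas [measurable]: "X u \<in> borel_measurable M" if "0 \<le> u" for u
    using X that by (auto simp: levy_process_def stochastic_process_def)
  have [measurable]: "X 0 \<in> borel_measurable M" "X s \<in> borel_measurable M" "X t \<in> borel_measurable M"
    using st by (auto intro!: meas)
  define \<tau> where "\<tau> i = (if i = 0 then 0 else if i = 1 then s else t)" for i :: nat
  have "0 \<le> \<tau> 0 \<and> (\<forall>i<2. \<tau> i \<le> \<tau> (Suc i))"
    using st by (auto simp: \<tau>_def)
  then have "indep_vars (\<lambda>_. borel) (\<lambda>i \<omega>. X (\<tau> (Suc i)) \<omega> - X (\<tau> i) \<omega>) {..<2}"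
    using X unfolding levy_process_def by blast
  moreover have "{..<2} = insert 0 {1::nat}" by auto
  ultimately have "indep_var borel (\<lambda>\<omega>. X (\<tau> (Suc 0)) \<omega> - X (\<tau> 0) \<omega>) borel
      (\<lambda>\<omega>. \<Sum>i\<in>{1}. X (\<tau> (Suc i)) \<omega> - X (\<tau> i) \<omega>)"
    by (intro indep_vars_sum) auto
  then have indep: "indep_var borel (\<lambda>\<omega>. X s \<omega> - X 0 \<omega>) borel (\<lambda>\<omega>. X t \<omega> - X s \<omega>)"
    by (simp add: \<tau>_def)
  have "AE \<omega> in M. X 0 \<omega> = 0" using X by (simp add: levy_process_def)
  then have ae: "AE \<omega> in M. X s \<omega> - X 0 \<omega> = X s \<omega>" by eventually_elim simp
  \<comment> \<open>Independence is a statement about joint and marginal laws, so almost sure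
    equality suffices for replacing \<open>X s - X 0\<close>.\<close>
  have "distr M borel (\<lambda>\<omega>. X s \<omega> - X 0 \<omega>) = distr M borel (X s)"
    by (rule distr_cong_AE) (use ae in auto)
  moreover have "distr M (borel \<Otimes>\<^sub>M borel) (\<lambda>\<omega>. (X s \<omega> - X 0 \<omega>, X t \<omega> - X s \<omega>)) =
      distr M (borel \<Otimes>\<^sub>M borel) (\<lambda>\<omega>. (X s \<omega>, X t \<omega> - X s \<omega>))"
    by (rule distr_cong_AE) (use ae in auto)
  ultimately show ?thesis
    using indep unfolding indep_var_distribution_eq by simp
qed

lemma (in prob_space) tempered_stable_square_integrable_subordinator:
  assumes S: "tempered_stable_subordinator M l \<alpha> S"
  shows "square_integrable_subordinator M S"
proof
  have par: "0 < l" "0 < \<alpha>" "\<alpha> < 1" and levy: "levy_process M S"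
    and dist: "\<And>t. 0 < t \<Longrightarrow> distributed M lborel (S t) (\<lambda>x. ennreal (tempered_stable_density l \<alpha> x t))"
    using S by (auto simp: tempered_stable_subordinator_def)
  show meas: "S t \<in> borel_measurable M" if "0 \<le> t" for t
    using levy that by (auto simp: levy_process_def stochastic_process_def)
  show nonneg: "0 \<le> S t \<omega>" if "0 \<le> t" "\<omega> \<in> space M" for t \<omega>
    using S that by (auto simp: tempered_stable_subordinator_def)
  show "S s \<omega> \<le> S t \<omega>" if "0 \<le> s" "s \<le> t" "\<omega> \<in> space M" for s t \<omega>
    using S that by (auto simp: tempered_stable_subordinator_def)
  show "indep_var borel (S s) borel (\<lambda>\<omega>. S t \<omega> - S s \<omega>)" if "0 \<le> s" "s \<le> t" for s t
    by (rule levy_process_indep_increment[OF levy that])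
  show "distr M borel (\<lambda>\<omega>. S t \<omega> - S s \<omega>) = distr M borel (S (t - s))" if "0 \<le> s" "s \<le> t" for s t
    using levy that by (auto simp: levy_process_def)
  show "integrable M (\<lambda>\<omega>. (S t \<omega>)\<^sup>2)" if "0 \<le> t" for t
  proof (cases "t = 0")
    \<comment> \<open>The density is prescribed for positive times only; at time 0 the clock
      vanishes almost surely.\<close>
    case True
    have ae: "AE \<omega> in M. (S t \<omega>)\<^sup>2 = 0" using levy True by (auto simp: levy_process_def)
    have "(\<lambda>\<omega>. (S t \<omega>)\<^sup>2) \<in> borel_measurable M" using meas[OF that] by measurable
    then show ?thesis using integrable_cong_AE[OF _ _ ae] by simp
  next
    case False
    then show ?thesis using tempered_stable_second_moment[OF dist par] nonneg that by simp
  qed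
  show "AE \<omega> in M. 0 < S t \<omega>" if "0 < t" for t
    using distributed_lborel_AE_neq[OF dist[OF that], of 0] AE_space
    by eventually_elim (use nonneg that in \<open>force simp: less_le\<close>)
qed

subsection \<open>Mixed fractional Brownian motion\<close>

text \<open>Packages the bare family of sets as a measure space, so that measurability and product
  spaces can refer to it; only its space and sets matter.\<close>

definition process_algebra :: "'a measure \<Rightarrow> (real \<Rightarrow> 'a \<Rightarrow> real) set \<Rightarrow> 'a measure" where
  "process_algebra M \<X> = sigma (space M) (process_sigma M \<X>)"

lemma process_sigma_sigma_algebra: "sigma_algebra (space M) (process_sigma M \<X>)"
  unfolding process_sigma_def by (rule sigma_algebra_sigma_sets) auto

lemma space_process_algebra [simp]: "space (process_algebra M \<X>) = space M"
  by (simp add: process_algebra_def space_measure_of_conv)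

lemma sets_process_algebra [simp]: "sets (process_algebra M \<X>) = process_sigma M \<X>"
  using process_sigma_sigma_algebra unfolding process_algebra_def by (rule sigma_algebra.sets_measure_of_eq)

lemma measurable_process_algebra:
  "X \<in> \<X> \<Longrightarrow> 0 \<le> t \<Longrightarrow> X t \<in> borel_measurable (process_algebra M \<X>)"
  by (rule measurableI) (auto simp: process_sigma_def intro!: sigma_sets.Basic)

definition fbm_covariance :: "real \<Rightarrow> real \<Rightarrow> real \<Rightarrow> real" where
  "fbm_covariance H s t = (s powr (2 * H) + t powr (2 * H) - \<bar>s - t\<bar> powr (2 * H)) / 2"

lemma fbm_covariance_self [simp]: "fbm_covariance H t t = t powr (2 * H)"
  by (simp add: fbm_covariance_def)

lemma (in prob_space)
  assumes B: "fractional_brownian_motion M H B"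
  shows fbm_measurable: "0 \<le> t \<Longrightarrow> B t \<in> borel_measurable M"
    and fbm_mean: "0 \<le> t \<Longrightarrow> expectation (B t) = 0"
    and fbm_product: "0 \<le> s \<Longrightarrow> 0 \<le> t \<Longrightarrow> expectation (\<lambda>\<omega>. B s \<omega> * B t \<omega>) = fbm_covariance H s t"
    and fbm_square_integrable: "0 \<le> t \<Longrightarrow> integrable M (\<lambda>\<omega>. (B t \<omega>)\<^sup>2)"
proof -
  show meas: "B t \<in> borel_measurable M" if "0 \<le> t" for t
    using B that by (simp add: fractional_brownian_motion_def gaussian_process_def stochastic_process_def)
  show "expectation (B t) = 0" if "0 \<le> t" for t
    using B that by (simp add: fractional_brownian_motion_def)
  show prod: "expectation (\<lambda>\<omega>. B s \<omega> * B t \<omega>) = fbm_covariance H s t" if "0 \<le> s" "0 \<le> t" for s t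
    using B that by (simp add: fractional_brownian_motion_def fbm_covariance_def)
  show "integrable M (\<lambda>\<omega>. (B t \<omega>)\<^sup>2)" if "0 \<le> t" for t
  proof (cases "t = 0")
    case True
    have "AE \<omega> in M. B 0 \<omega> = 0" using B by (simp add: fractional_brownian_motion_def)
    then have ae: "AE \<omega> in M. (B t \<omega>)\<^sup>2 = 0" unfolding True by eventually_elim simp
    have "(\<lambda>\<omega>. (B t \<omega>)\<^sup>2) \<in> borel_measurable M" using meas[OF that] by measurable
    then show ?thesis using integrable_cong_AE[OF _ _ ae] by simp
  next
    case False
    \<comment> \<open>A non-integrable function has integral 0, whereas this second moment is positive.\<close>
    then have "expectation (\<lambda>\<omega>. (B t \<omega>)\<^sup>2) \<noteq> 0"
      using prod[OF that that] by (simp add: power2_eq_square)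
    then show ?thesis using not_integrable_integral_eq by blast
  qed
qed

text \<open>The sigma-algebra of one time is contained in that of the process, and independence
  passes to subfamilies.\<close>

lemma (in prob_space) indep_var_of_process_sigma:
  assumes indep: "indep_set (process_sigma M \<X>) (process_sigma M \<Y>)"
    and X: "X \<in> \<X>" "0 \<le> s" and Y: "Y \<in> \<Y>" "0 \<le> t"
  shows "indep_var borel (X s) borel (Y t)"
proof -
  have sub: "sigma_sets (space M) {Z u -` A \<inter> space M |A. A \<in> sets borel} \<subseteq> process_sigma M \<Z>"
    if "Z \<in> \<Z>" "0 \<le> u" for Z \<Z> and u :: real
    using measurable_sets[OF measurable_process_algebra[OF that, of M]]
    by (intro sigma_algebra.sigma_sets_subset[OF process_sigma_sigma_algebra]) auto
  have meas: "Z u \<in> borel_measurable M" if "process_sigma M \<Z> \<subseteq> events" "Z \<in> \<Z>" "0 \<le> u" for Z \<Z> and u :: real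
    using measurable_process_algebra[OF that(2,3), of M] that(1)
      measurable_mono[of borel borel "process_algebra M \<Z>" M] by auto
  show ?thesis
    unfolding indep_var_eq
    using meas[OF indep_setD_ev1[OF indep] X] meas[OF indep_setD_ev2[OF indep] Y] sub[OF X] sub[OF Y] indep
    unfolding indep_sets2_eq by blast
qed

text \<open>Independence and zero means remove the mixed terms from the expanded product, leaving a
  weighted sum of the two fractional covariances.\<close>

lemma (in prob_space)
  assumes N: "generalized_mixed_fbm M H1 H2 a b B1 B2 N"
  shows mixed_fbm_square_integrable: "0 \<le> t \<Longrightarrow> integrable M (\<lambda>\<omega>. (N t \<omega>)\<^sup>2)"
    and mixed_fbm_mean: "0 \<le> t \<Longrightarrow> expectation (N t) = 0"
    and mixed_fbm_product: "0 \<le> s \<Longrightarrow> 0 \<le> t \<Longrightarrow>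
      expectation (\<lambda>\<omega>. N s \<omega> * N t \<omega>) = a\<^sup>2 * fbm_covariance H1 s t + b\<^sup>2 * fbm_covariance H2 s t"
proof -
  have B1: "fractional_brownian_motion M H1 B1" and B2: "fractional_brownian_motion M H2 B2"
    and indep: "indep_set (process_sigma M {B1}) (process_sigma M {B2})"
    and N_def: "N = mixed_process a b B1 B2"
    using N by (auto simp: generalized_mixed_fbm_def)
  note m1 = fbm_measurable[OF B1] and m2 = fbm_measurable[OF B2]
  have i1: "integrable M (B1 t)" and i2: "integrable M (B2 t)" if "0 \<le> t" for t
    using square_integrable_imp_integrable[OF m1 fbm_square_integrable[OF B1]]
      square_integrable_imp_integrable[OF m2 fbm_square_integrable[OF B2]] that by auto
  have cross: "integrable M (\<lambda>\<omega>. B1 s \<omega> * B2 t \<omega>)" "expectation (\<lambda>\<omega>. B1 s \<omega> * B2 t \<omega>) = 0"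
    if "0 \<le> s" "0 \<le> t" for s t
  proof -
    have ind: "indep_var borel (B1 s) borel (B2 t)"
      by (rule indep_var_of_process_sigma[OF indep]) (use that in auto)
    show "integrable M (\<lambda>\<omega>. B1 s \<omega> * B2 t \<omega>)"
      by (rule indep_var_integrable[OF ind i1[OF that(1)] i2[OF that(2)]])
    show "expectation (\<lambda>\<omega>. B1 s \<omega> * B2 t \<omega>) = 0"
      using indep_var_lebesgue_integral[OF ind i1[OF that(1)] i2[OF that(2)]] that
      by (simp add: fbm_mean[OF B1])
  qed
  have prod_int: "integrable M (\<lambda>\<omega>. B s \<omega> * B t \<omega>)"
    if B: "fractional_brownian_motion M H B" and "0 \<le> s" "0 \<le> t" for B H s t
  proof (rule Bochner_Integration.integrable_bound)
    show "integrable M (\<lambda>\<omega>. (B s \<omega>)\<^sup>2 + (B t \<omega>)\<^sup>2)"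
      using fbm_square_integrable[OF B] that by simp
    show "(\<lambda>\<omega>. B s \<omega> * B t \<omega>) \<in> borel_measurable M"
      using fbm_measurable[OF B that(2)] fbm_measurable[OF B that(3)] by measurable
    show "AE \<omega> in M. norm (B s \<omega> * B t \<omega>) \<le> norm ((B s \<omega>)\<^sup>2 + (B t \<omega>)\<^sup>2)"
      by (intro AE_I2 norm_mult_le_sum_squares)
  qed
  have expand: "N s \<omega> * N t \<omega> = a\<^sup>2 * (B1 s \<omega> * B1 t \<omega>) + a * b * (B1 s \<omega> * B2 t \<omega>)
      + a * b * (B1 t \<omega> * B2 s \<omega>) + b\<^sup>2 * (B2 s \<omega> * B2 t \<omega>)" for s t \<omega>
    by (simp add: N_def mixed_process_def power2_eq_square algebra_simps)
  show "expectation (\<lambda>\<omega>. N s \<omega> * N t \<omega>) = a\<^sup>2 * fbm_covariance H1 s t + b\<^sup>2 * fbm_covariance H2 s t"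
    if "0 \<le> s" "0 \<le> t" for s t
    unfolding expand using that cross prod_int[OF B1] prod_int[OF B2]
    by (simp add: fbm_product[OF B1] fbm_product[OF B2])
  show "integrable M (\<lambda>\<omega>. (N t \<omega>)\<^sup>2)" if "0 \<le> t" for t
    unfolding power2_eq_square expand using that cross prod_int[OF B1] prod_int[OF B2] by simp
  show "expectation (N t) = 0" if "0 \<le> t" for t
    unfolding N_def mixed_process_def using that i1 i2
    by (simp add: fbm_mean[OF B1] fbm_mean[OF B2])
qed

lemma mixed_fbm_time_change:
  assumes "prob_space M" and N: "generalized_mixed_fbm M H1 H2 a b B1 B2 N"
    and indep: "prob_space.indep_set M (process_sigma M {B1, B2}) (process_sigma M {S})"
  shows "independent_time_change M (process_algebra M {B1, B2}) (process_algebra M {S}) N"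
proof -
  interpret prob_space M by fact
  have B1: "fractional_brownian_motion M H1 B1" and B2: "fractional_brownian_motion M H2 B2"
    and N_def: "N = mixed_process a b B1 B2"
    using N by (auto simp: generalized_mixed_fbm_def)
  show ?thesis
  proof
    show "N t \<in> borel_measurable (process_algebra M {B1, B2})" if "0 \<le> t" for t
      unfolding N_def mixed_process_def using that
      by (intro borel_measurable_add borel_measurable_times borel_measurable_const measurable_process_algebra) auto
    show "continuous_on {0..} (\<lambda>t. N t \<omega>)" if "\<omega> \<in> space M" for \<omega>
      unfolding N_def mixed_process_def using that B1 B2
      by (intro continuous_intros) (auto simp: fractional_brownian_motion_def)
  qed (use indep in \<open>auto simp: mixed_fbm_square_integrable[OF N] mixed_fbm_mean[OF N]\<close>)
qed

section \<open>Asymptotics of the correlation of the time-changed process\<close>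

theorem theorem2p3:
  fixes M :: "'a measure"
    and B1 B2 N S :: "real \<Rightarrow> 'a \<Rightarrow> real"
    and H1 H2 a b lam \<alpha> :: real
  assumes "prob_space M"
    and "0 < H1" and "H1 \<le> H2" and "H2 < 1"
    and "generalized_mixed_fbm M H1 H2 a b B1 B2 N"
    and "0 < lam" and "0 < \<alpha>" and "\<alpha> < 1"
    and "tempered_stable_subordinator M lam \<alpha> S"
    and "prob_space.indep_set M (process_sigma M {B1, B2}) (process_sigma M {S})"
    and "2 * H1 - H2 < 1"
  shows "long_range_dependent M (time_changed N S)"
proof -
  note N = assms(5)
  interpret prob_space M by fact
  interpret S: square_integrable_subordinator M S
    by (rule tempered_stable_square_integrable_subordinator[OF assms(9)])
  interpret independent_time_change M "process_algebra M {B1, B2}" "process_algebra M {S}" N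
    by (rule mixed_fbm_time_change[OF assms(1) N assms(10)])
  let ?X = "time_changed N S"
  define p1 p2 where "p1 = 2 * H1" and "p2 = 2 * H2"
  have p: "0 < p1" "p1 \<le> p2" "0 < p2" "p1 \<le> 2" "p2 \<le> 2"
    using assms by (auto simp: p1_def p2_def)
  have ab: "a \<noteq> 0 \<or> b \<noteq> 0" using N by (auto simp: generalized_mixed_fbm_def)
  have S_meas: "S t \<in> borel_measurable (process_algebra M {S})" if "0 \<le> t" for t
    using that by (intro measurable_process_algebra) auto
  have sq: "expectation (\<lambda>\<omega>'. (N u \<omega>')\<^sup>2) = a\<^sup>2 * u powr p1 + b\<^sup>2 * u powr p2" if "0 \<le> u" for u
    using mixed_fbm_product[OF N that that] by (simp add: power2_eq_square p1_def p2_def)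
  \<comment> \<open>At a frozen clock value the second moment is a combination of powers of order at
    most 2, which the clock integrates.\<close>
  have int: "integrable M (\<lambda>\<omega>. expectation (\<lambda>\<omega>'. (N (S t \<omega>) \<omega>')\<^sup>2))" if "0 \<le> t" for t
    by (subst Bochner_Integration.integrable_cong[OF refl sq[OF S.S_nonneg[OF that]]])
      (use that p in auto)
  have X_mean: "expectation (?X t) = 0" if "0 \<le> t" for t
    using expectation_time_change[OF S_meas S.S_nonneg int] that
    by (simp add: time_changed_def[abs_def])
  have X_prod: "covariance M (?X t) (?X s) =
      expectation (\<lambda>\<omega>. a\<^sup>2 * fbm_covariance H1 (S t \<omega>) (S s \<omega>) + b\<^sup>2 * fbm_covariance H2 (S t \<omega>) (S s \<omega>))"
    if "0 \<le> s" "0 \<le> t" for s t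
  proof -
    have "covariance M (?X t) (?X s) = expectation (\<lambda>\<omega>. N (S t \<omega>) \<omega> * N (S s \<omega>) \<omega>)"
      unfolding covariance_def X_mean[OF that(1)] X_mean[OF that(2)] by (simp add: time_changed_def)
    also have "\<dots> = expectation (\<lambda>\<omega>. expectation (\<lambda>\<omega>'. N (S t \<omega>) \<omega>' * N (S s \<omega>) \<omega>'))"
      using that by (intro expectation_time_change_product S_meas S.S_nonneg int)
    finally show ?thesis
      using that S.S_nonneg
      by (simp add: mixed_fbm_product[OF N] cong: Bochner_Integration.integral_cong)
  qed
  define A where "A q t = expectation (\<lambda>\<omega>. S t \<omega> powr q)" for q t
  \<comment> \<open>For \<open>s \<le> t\<close> and \<open>q = 2 * H\<close>, \<open>D\<close> is
    twice the averaged fractional covariance at the two clock values; hence the weights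
    \<open>a\<^sup>2 / 2\<close> and \<open>b\<^sup>2 / 2\<close> below.\<close>
  define D where "D q s t = expectation (\<lambda>\<omega>. S t \<omega> powr q + S s \<omega> powr q - (S t \<omega> - S s \<omega>) powr q)" for q s t
  have X_var: "covariance M (?X t) (?X t) = a\<^sup>2 * A p1 t + b\<^sup>2 * A p2 t" if "0 \<le> t" for t
    unfolding X_prod[OF that that] fbm_covariance_self A_def using that p
    by (simp add: p1_def[symmetric] p2_def[symmetric])
  have X_cov: "covariance M (?X t) (?X s) = a\<^sup>2 / 2 * D p1 s t + b\<^sup>2 / 2 * D p2 s t"
    if st: "0 \<le> s" "s \<le> t" for s t
  proof -
    have t: "0 \<le> t" using st by simp
    have int_D: "integrable M (\<lambda>\<omega>. S t \<omega> powr q + S s \<omega> powr q - (S t \<omega> - S s \<omega>) powr q)"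
      if "0 < q" "q \<le> 2" for q
      using S.increment_transfer(1)[OF st, of "\<lambda>x. x powr q"] that st t by simp
    have K: "fbm_covariance H (S t \<omega>) (S s \<omega>) =
        (S t \<omega> powr (2 * H) + S s \<omega> powr (2 * H) - (S t \<omega> - S s \<omega>) powr (2 * H)) / 2"
      if "\<omega> \<in> space M" for H \<omega>
      using S.S_mono[OF st that] by (simp add: fbm_covariance_def)
    have "covariance M (?X t) (?X s) = expectation (\<lambda>\<omega>.
        a\<^sup>2 / 2 * (S t \<omega> powr p1 + S s \<omega> powr p1 - (S t \<omega> - S s \<omega>) powr p1) +
        b\<^sup>2 / 2 * (S t \<omega> powr p2 + S s \<omega> powr p2 - (S t \<omega> - S s \<omega>) powr p2))"
      unfolding X_prod[OF st(1) t]
      by (intro Bochner_Integration.integral_cong) (simp_all add: K p1_def p2_def)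
    then show ?thesis
      using int_D[OF p(1,4)] int_D[OF p(3,5)] unfolding D_def by simp
  qed
  have var_pos: "0 < covariance M (?X s) (?X s)" if "0 < s" for s
  proof -
    have "0 < A p1 s" "0 < A p2 s"
      unfolding A_def using p that by (auto intro: S.powr_moment_pos)
    then show ?thesis using ab that
      by (auto simp: X_var intro: add_pos_nonneg add_nonneg_pos)
  qed
  have "((\<lambda>t. A p1 t / t powr p1) \<longlongrightarrow> S.\<mu> powr p1) at_top" "((\<lambda>t. A p2 t / t powr p2) \<longlongrightarrow> S.\<mu> powr p2) at_top"
    unfolding A_def using p by (auto intro: S.powr_moment_asymp)
  then obtain V where V: "0 < V"
    "((\<lambda>t. (a\<^sup>2 * A p1 t + b\<^sup>2 * A p2 t) / t powr (if b\<^sup>2 = 0 then p1 else p2)) \<longlongrightarrow> V) at_top"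
    by (rule weighted_powr_combination[where ?w1.0 = "a\<^sup>2" and ?w2.0 = "b\<^sup>2"]) (use p ab S.mean_pos in auto)
  \<comment> \<open>Since \<open>p1 \<le> p2\<close>, the exponent \<open>p2\<close> governs as soon
    as \<open>b\<close> is nonzero.\<close>
  define P where "P = (if b = 0 then p1 else p2)"
  have V': "((\<lambda>t. (a\<^sup>2 * A p1 t + b\<^sup>2 * A p2 t) / t powr P) \<longlongrightarrow> V) at_top"
    using V by (simp add: P_def)
  \<comment> \<open>The map from \<open>p\<close> to \<open>max 0 (p - 1)\<close> is monotone, so
    the dominant index of the covariance is the same as that of the variance.\<close>
  define e where "e = max 0 (P - 1)"
  have "\<exists>c. c \<noteq> 0 \<and> (\<lambda>t. correlation M (?X t) (?X s)) \<sim>[at_top] (\<lambda>t. c * t powr - (P / 2 - e))"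
    if s: "0 < s" for s
  proof -
    obtain L1 where L1: "0 < L1" "((\<lambda>t. D p1 s t / t powr max 0 (p1 - 1)) \<longlongrightarrow> L1) at_top"
      unfolding D_def by (rule S.powr_moment_kernel_asymp[OF p(1,4) s])
    obtain L2 where L2: "0 < L2" "((\<lambda>t. D p2 s t / t powr max 0 (p2 - 1)) \<longlongrightarrow> L2) at_top"
      unfolding D_def by (rule S.powr_moment_kernel_asymp[OF p(3,5) s])
    obtain L where L: "0 < L" "((\<lambda>t. (a\<^sup>2 / 2 * D p1 s t + b\<^sup>2 / 2 * D p2 s t)
        / t powr (if b\<^sup>2 / 2 = 0 then max 0 (p1 - 1) else max 0 (p2 - 1))) \<longlongrightarrow> L) at_top"
      by (rule weighted_powr_combination[OF L1(2) L2(2) L1(1) L2(1),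
            where ?w1.0 = "a\<^sup>2 / 2" and ?w2.0 = "b\<^sup>2 / 2"]) (use p ab in auto)
    have e: "(if b\<^sup>2 / 2 = 0 then max 0 (p1 - 1) else max 0 (p2 - 1)) = e"
      by (simp add: e_def P_def)
    let ?V = "covariance M (?X s) (?X s)"
    \<comment> \<open>The correlation with its growth rates divided out: each factor converges
      separately, and the limit is nonzero because both variances and \<open>L\<close> are
      positive.\<close>
    let ?f = "\<lambda>t. (a\<^sup>2 / 2 * D p1 s t + b\<^sup>2 / 2 * D p2 s t) / t powr e
      / sqrt ((a\<^sup>2 * A p1 t + b\<^sup>2 * A p2 t) / t powr P * ?V)"
    have "(?f \<longlongrightarrow> L / sqrt (V * ?V)) at_top"
      using L(2) V(1) var_pos[OF s] unfolding e by (intro tendsto_intros V') auto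
    moreover have "\<forall>\<^sub>F t in at_top. ?f t = correlation M (?X t) (?X s) / t powr - (P / 2 - e)"
      using eventually_gt_at_top[of s]
    proof eventually_elim
      case (elim t)
      then have "0 \<le> s" "s \<le> t" "0 \<le> t" "0 < t" using s by auto
      then show ?case
        unfolding X_cov[OF \<open>0 \<le> s\<close> \<open>s \<le> t\<close>, symmetric] X_var[OF \<open>0 \<le> t\<close>, symmetric] correlation_def
        by (intro divide_powr_sqrt_powr)
    qed
    ultimately have lim: "((\<lambda>t. correlation M (?X t) (?X s) / t powr - (P / 2 - e)) \<longlongrightarrow> L / sqrt (V * ?V)) at_top"
      by (rule Lim_transform_eventually)
    have nz: "L / sqrt (V * ?V) \<noteq> 0" using L(1) V(1) var_pos[OF s] by simp
    show ?thesis
      by (intro exI[of _ "L / sqrt (V * ?V)"] conjI nz asymp_equivI'_const[OF lim nz])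
  qed
  \<comment> \<open>Neither \<open>P\<close> nor \<open>e\<close> depends on \<open>s\<close>, so
    one exponent serves all \<open>s\<close> and only the constant is chosen for each.\<close>
  then obtain c where "\<forall>s>0. c s \<noteq> 0 \<and>
      (\<lambda>t. correlation M (?X t) (?X s)) \<sim>[at_top] (\<lambda>t. c s * t powr - (P / 2 - e))"
    by metis
  moreover have "stochastic_process M ?X"
    unfolding stochastic_process_def time_changed_def[abs_def]
    using measurable_time_change[OF S_meas S.S_nonneg] by simp
  moreover have "integrable M (\<lambda>\<omega>. (?X t \<omega>)\<^sup>2)" if "0 \<le> t" for t
    unfolding time_changed_def using integrable_time_change_square[OF S_meas S.S_nonneg int] that by simp
  ultimately show ?thesis
    unfolding long_range_dependent_def by blast
qed

end
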